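(* Every sequential rectifiable regular topological space $X$ of countable $\mathrm{cs}^*$-character is paracompact and submetrizable.
   Context: All topological spaces are assumed to be regular (including the $T_1$ axiom). A topological space $X$ is rectifiable if there exist a point $e\in X$ and a homeomorphism $h:X\times X\to X\times X$ such that $h(x,e)=(x,x)$ and $h(\{x\}\times X)\subset\{x\}\times X$ for every $x\in X$. A family $\mathcal N$ of subsets of $X$ is a $\mathrm{cs}^*$-network at a point $x\in X$ if for each neighborhood $O_x$ of $x$ and each sequence $(x_n)_{n\in\omega}$ in $X$ converging to $x$ there is $N\in\mathcal N$ such that $x\in N\subset O_x$ and $x_n\in N$ for infinitely many $n$. The space $X$ has countable $\mathrm{cs}^*$-character if at each point $x\in X$ it has a countable $\mathrm{cs}^*$-network. A space $X$ is sequential if for each non-closed subset $A\subset X$ there is a sequence in $A$ that converges in $X$ to a point $x\notin A$. A space $X$ is submetrizable if it admits a continuous metric, i.e. a metric $d:X\times X\to\mathbb R$ that is continuous with respect to the topology of $X$. *)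

theory Defs
  imports "HOL-Analysis.Analysis"
begin

definition rectifiable_space :: "'a topology \<Rightarrow> bool" where
  "rectifiable_space X \<longleftrightarrow>
     (\<exists>e \<in> topspace X. \<exists>h.
        homeomorphic_map (prod_topology X X) (prod_topology X X) h \<and>
        (\<forall>x \<in> topspace X. h (x, e) = (x, x) \<and>
           h ` ({x} \<times> topspace X) \<subseteq> {x} \<times> topspace X))"

(* The sequences are required to lie entirely in the space: limitin alone
   only forces this for all but finitely many terms. *)

definition cs_star_network_at :: "'a topology \<Rightarrow> 'a \<Rightarrow> 'a set set \<Rightarrow> bool" where
  "cs_star_network_at X x \<N> \<longleftrightarrow>
     \<N> \<subseteq> Pow (topspace X) \<and>
     (\<forall>U s. openin X U \<and> x \<in> U \<and>
        range s \<subseteq> topspace X \<and> limitin X s x sequentially \<longrightarrow>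
        (\<exists>N \<in> \<N>. x \<in> N \<and> N \<subseteq> U \<and> infinite {n::nat. s n \<in> N}))"

definition countable_cs_star_character :: "'a topology \<Rightarrow> bool" where
  "countable_cs_star_character X \<longleftrightarrow>
     (\<forall>x \<in> topspace X. \<exists>\<N>. countable \<N> \<and> cs_star_network_at X x \<N>)"

definition sequential_space :: "'a topology \<Rightarrow> bool" where
  "sequential_space X \<longleftrightarrow>
     (\<forall>A. A \<subseteq> topspace X \<and> \<not> closedin X A \<longrightarrow>
        (\<exists>(s :: nat \<Rightarrow> 'a) x. range s \<subseteq> A \<and> x \<notin> A \<and> limitin X s x sequentially))"

(* The metric need not induce the topology of X. *)

definition submetrizable_space :: "'a topology \<Rightarrow> bool" where
  "submetrizable_space X \<longleftrightarrow>
     (\<exists>d. Metric_space (topspace X) d \<and>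
        continuous_map (prod_topology X X) euclideanreal (\<lambda>(x, y). d x y))"

(* As usual (Engelking), paracompactness includes the Hausdorff axiom. *)

definition paracompact_space :: "'a topology \<Rightarrow> bool" where
  "paracompact_space X \<longleftrightarrow>
     Hausdorff_space X \<and>
     (\<forall>\<U>. (\<forall>U \<in> \<U>. openin X U) \<and> \<Union>\<U> = topspace X \<longrightarrow>
        (\<exists>\<V>. (\<forall>V \<in> \<V>. openin X V) \<and> \<Union>\<V> = topspace X \<and>
           (\<forall>V \<in> \<V>. \<exists>U \<in> \<U>. V \<subseteq> U) \<and> locally_finite_in X \<V>))"

end

theory Submission
  imports Defs
begin

text \<open>Let \<open>e\<close> be the distinguished point of \<open>X\<close>, let \<open>mu\<close> and \<open>dl\<close> be the continuous
  multiplication and left division given by the homeomorphism \<open>h\<close>, and let \<open>\<N>\<close> be a countable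
  cs*-network at \<open>e\<close> of closed sets. Call a set a barrier if it meets every sequence converging
  to \<open>e\<close>.

  If every neighbourhood of \<open>e\<close> contains a finite union of members of \<open>\<N>\<close> that is a barrier, then a
  diagonal argument shows that \<open>X\<close> is Frechet-Urysohn, so these finite unions are neighbourhoods
  of \<open>e\<close> and \<open>X\<close> is first countable. The relations \<open>dl x y \<in> U\<close> then serve as substitutes for
  metric balls in Rudin's proof of Stone's theorem.

  Otherwise there is a double sequence whose rows converge to \<open>e\<close> while no sequence meeting
  infinitely many rows converges at all. By sequentiality \<open>X\<close> then contains no metric fan, and this
  forces every sequence converging to \<open>e\<close> to be eventually in a finite intersection of finite
  unions of members of \<open>\<N>\<close> that is totally bounded with respect to \<open>\<N>\<close>. Such a set has a countable
  network. Let \<open>K\<close> be the union of these countably many sets. Every set \<open>T\<close> with \<open>mu T K \<subseteq> T\<close> is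
  clopen, and the smallest such set containing a given point has a countable network; well-ordering
  the points of \<open>X\<close> turns these clopen sets into a partition, whence \<open>X\<close> is paracompact and \<open>{e}\<close>
  is a \<open>G\<^sub>\<delta>\<close> set.

  In both cases the diagonal of \<open>X\<close> is a \<open>G\<^sub>\<delta>\<close> set, and paracompactness gives a continuous
  metric.\<close>

section \<open>Sequences, continuity and countable networks\<close>

lemma continuous_map_pair_nhds:
  assumes f: "continuous_map (prod_topology X Y) Z (\<lambda>(x, y). f x y)"
    and "x \<in> topspace X" "y \<in> topspace Y" "openin Z W" "f x y \<in> W"
  obtains U V where "openin X U" "x \<in> U" "openin Y V" "y \<in> V"
    "\<And>a b. a \<in> U \<Longrightarrow> b \<in> V \<Longrightarrow> f a b \<in> W"
proof -
  let ?P = "{p \<in> topspace (prod_topology X Y). (\<lambda>(x, y). f x y) p \<in> W}"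
  have "openin (prod_topology X Y) ?P"
    using f \<open>openin Z W\<close> openin_continuous_map_preimage by blast
  moreover have "(x, y) \<in> ?P"
    using assms by simp
  ultimately obtain U V where "openin X U" "openin Y V" "x \<in> U" "y \<in> V" "U \<times> V \<subseteq> ?P"
    using iffD1[OF openin_prod_topology_alt, rule_format, of X Y ?P x y] by blast
  then show thesis
    by (intro that[of U V]) auto
qed

lemma limitin_continuous_map_pair:
  assumes f: "continuous_map (prod_topology X Y) Z (\<lambda>(x, y). f x y)"
    and "limitin X s x F" "limitin Y t y F"
  shows "limitin Z (\<lambda>n. f (s n) (t n)) (f x y) F"
proof -
  have "limitin (prod_topology X Y) (\<lambda>n. (s n, t n)) (x, y) F"
    using assms by (simp add: limitin_pairwise o_def)
  from continuous_map_limit[OF f this] show ?thesis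
    by (simp add: o_def)
qed

lemma limitin_compose_filterlim:
  assumes "limitin X s x F" "filterlim r F G"
  shows "limitin X (\<lambda>n. s (r n)) x G"
  using assms unfolding limitin_def by (auto simp: filterlim_iff)

lemma regular_space_shrink:
  assumes "regular_space X" "openin X U" "x \<in> U"
  obtains V where "openin X V" "x \<in> V" "X closure_of V \<subseteq> U"
proof -
  have "closedin X (topspace X - U)" "x \<in> topspace X - (topspace X - U)"
    using assms openin_subset by auto
  then obtain V where "openin X V" "x \<in> V" "disjnt (topspace X - U) (X closure_of V)"
    using \<open>regular_space X\<close> unfolding regular_space by metis
  moreover have "X closure_of V \<subseteq> topspace X"
    by (simp add: closure_of_subset_topspace)
  ultimately show thesis
    by (intro that[of V]) (auto simp: disjnt_def)
qed

lemma closedin_sequential_space: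
  assumes "sequential_space X" "A \<subseteq> topspace X"
    and "\<And>s x. range s \<subseteq> A \<Longrightarrow> limitin X s x sequentially \<Longrightarrow> x \<in> A"
  shows "closedin X A"
  using assms unfolding sequential_space_def by metis

text \<open>If no value occurs infinitely often, arbitrarily late terms exceed any bound, and a
  greedy choice makes index and value increase together. This separates the ways in which a sequence
  can run through a doubly indexed set.\<close>

lemma nat_seq_constant_or_strict_mono:
  fixes k :: "nat \<Rightarrow> nat"
  obtains r c where "strict_mono (r :: nat \<Rightarrow> nat)" "\<And>j. k (r j) = c"
    | r where "strict_mono (r :: nat \<Rightarrow> nat)" "strict_mono (k \<circ> r)"
proof (cases "\<exists>c. infinite {j. k j = c}")
  case True
  then obtain c where "infinite {j. k j = c}" ..
  then obtain r where "strict_mono (r :: nat \<Rightarrow> nat)" "\<forall>j. r j \<in> {j. k j = c}"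
    using infinite_enumerate by blast
  then show thesis
    using that(1) by auto
next
  case False
  have big: "\<exists>j>n. k j > b" for n b
  proof (rule ccontr)
    assume "\<not> ?thesis"
    then have "k j \<le> b" if "j > n" for j
      using that by (meson not_less)
    then have "{n<..} \<subseteq> (\<Union>c\<le>b. {j. k j = c})"
      by auto
    moreover have "finite (\<Union>c\<le>b. {j. k j = c})"
      using False by auto
    ultimately show False
      using infinite_Ioi finite_subset by blast
  qed
  obtain r where r: "\<And>n. r n < r (Suc n) \<and> k (r n) < k (r (Suc n))"
    using dependent_nat_choice[of "\<lambda>_ _. True" "\<lambda>_ x y. x < y \<and> k x < k y"] big by auto
  then have "strict_mono r" "strict_mono (k \<circ> r)"
    by (auto simp: strict_mono_Suc_iff)
  then show thesis
    using that(2) by blast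
qed

section \<open>Countable networks of subsets\<close>

text \<open>The traces of \<open>\<W>\<close> on \<open>P\<close> form a network of the subspace
  \<open>P\<close>; the members of \<open>\<W>\<close> themselves may leave
  \<open>P\<close>.\<close>

definition has_countable_network :: "'a topology \<Rightarrow> 'a set \<Rightarrow> bool" where
  "has_countable_network X P \<longleftrightarrow> (\<exists>\<W>. countable \<W> \<and>
     (\<forall>x\<in>P. \<forall>U. openin X U \<and> x \<in> U \<longrightarrow> (\<exists>W\<in>\<W>. x \<in> W \<and> W \<subseteq> U)))"

lemma has_countable_network_singleton: "has_countable_network X {x}"
  unfolding has_countable_network_def by (intro exI[of _ "{{x}}"]) auto

lemma has_countable_network_UN:
  assumes "countable I" "\<And>i. i \<in> I \<Longrightarrow> has_countable_network X (P i)"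
  shows "has_countable_network X (\<Union>i\<in>I. P i)"
proof -
  have "\<forall>i\<in>I. \<exists>\<W>. countable \<W> \<and>
     (\<forall>x\<in>P i. \<forall>U. openin X U \<and> x \<in> U \<longrightarrow> (\<exists>W\<in>\<W>. x \<in> W \<and> W \<subseteq> U))"
    using assms(2) unfolding has_countable_network_def by blast
  from bchoice[OF this] obtain \<W> where \<W>: "\<forall>i\<in>I. countable (\<W> i) \<and>
     (\<forall>x\<in>P i. \<forall>U. openin X U \<and> x \<in> U \<longrightarrow> (\<exists>W\<in>\<W> i. x \<in> W \<and> W \<subseteq> U))" ..
  show ?thesis
    unfolding has_countable_network_def
  proof (intro exI[of _ "\<Union>i\<in>I. \<W> i"] conjI ballI allI impI)
    show "countable (\<Union>i\<in>I. \<W> i)"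
      using \<W> assms(1) by auto
  next
    fix x U assume "x \<in> (\<Union>i\<in>I. P i)" and U: "openin X U \<and> x \<in> U"
    then obtain i where "i \<in> I" "x \<in> P i" by blast
    with \<W> U obtain W where "W \<in> \<W> i" "x \<in> W" "W \<subseteq> U" by meson
    with \<open>i \<in> I\<close> show "\<exists>W\<in>(\<Union>i\<in>I. \<W> i). x \<in> W \<and> W \<subseteq> U" by blast
  qed
qed

text \<open>Continuity at \<open>(p, q)\<close> yields a rectangle of neighbourhoods; network
  members inside its sides have their image inside the given open set, and there are only countably
  many pairs of members.\<close>

lemma has_countable_network_continuous_pair_image:
  assumes f: "continuous_map (prod_topology X X) X (\<lambda>(x, y). f x y)"
    and "P \<subseteq> topspace X" "Q \<subseteq> topspace X"
    and "has_countable_network X P" "has_countable_network X Q"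
  shows "has_countable_network X {f p q |p q. p \<in> P \<and> q \<in> Q}"
proof -
  obtain \<U> where \<U>: "countable \<U>"
    "\<And>x U. x \<in> P \<Longrightarrow> openin X U \<Longrightarrow> x \<in> U \<Longrightarrow> \<exists>W\<in>\<U>. x \<in> W \<and> W \<subseteq> U"
    using assms(4) unfolding has_countable_network_def by meson
  obtain \<V> where \<V>: "countable \<V>"
    "\<And>x U. x \<in> Q \<Longrightarrow> openin X U \<Longrightarrow> x \<in> U \<Longrightarrow> \<exists>W\<in>\<V>. x \<in> W \<and> W \<subseteq> U"
    using assms(5) unfolding has_countable_network_def by meson
  define \<W> where "\<W> = (\<lambda>(U, V). {f p q |p q. p \<in> U \<and> q \<in> V}) ` (\<U> \<times> \<V>)"
  show ?thesis
    unfolding has_countable_network_def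
  proof (intro exI[of _ \<W>] conjI ballI allI impI)
    show "countable \<W>"
      unfolding \<W>_def using \<U>(1) \<V>(1) by auto
  next
    fix x O' assume x: "x \<in> {f p q |p q. p \<in> P \<and> q \<in> Q}" and O': "openin X O' \<and> x \<in> O'"
    then obtain p q where pq: "x = f p q" "p \<in> P" "q \<in> Q" by blast
    then have "p \<in> topspace X" "q \<in> topspace X" "openin X O'" "f p q \<in> O'"
      using assms(2,3) O' by auto
    from continuous_map_pair_nhds[OF f this] obtain U V where
      UV: "openin X U" "p \<in> U" "openin X V" "q \<in> V" "\<And>a b. a \<in> U \<Longrightarrow> b \<in> V \<Longrightarrow> f a b \<in> O'"
      by blast
    obtain U' where "U' \<in> \<U>" "p \<in> U'" "U' \<subseteq> U"
      using \<U>(2)[OF pq(2) UV(1,2)] by blast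
    moreover obtain V' where "V' \<in> \<V>" "q \<in> V'" "V' \<subseteq> V"
      using \<V>(2)[OF pq(3) UV(3,4)] by blast
    ultimately show "\<exists>W\<in>\<W>. x \<in> W \<and> W \<subseteq> O'"
      using UV(5) pq(1) unfolding \<W>_def
      by (intro bexI[of _ "{f p q |p q. p \<in> U' \<and> q \<in> V'}"]) (blast, force)
  qed
qed

section \<open>Paracompact spaces\<close>

lemma paracompact_space_refinement:
  assumes "paracompact_space X" "\<And>U. U \<in> \<U> \<Longrightarrow> openin X U" "topspace X \<subseteq> \<Union>\<U>"
  obtains \<V> where "\<And>V. V \<in> \<V> \<Longrightarrow> openin X V" "\<Union>\<V> = topspace X"
    "\<And>V. V \<in> \<V> \<Longrightarrow> \<exists>U\<in>\<U>. V \<subseteq> U" "locally_finite_in X \<V>"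
proof -
  have "\<Union>\<U> = topspace X"
    using assms(2,3) openin_subset by blast
  with assms(2) have "(\<forall>U \<in> \<U>. openin X U) \<and> \<Union>\<U> = topspace X" by simp
  from assms(1)[unfolded paracompact_space_def, THEN conjunct2, THEN spec, THEN mp, OF this]
  obtain \<V> where "(\<forall>V \<in> \<V>. openin X V) \<and> \<Union>\<V> = topspace X \<and>
      (\<forall>V \<in> \<V>. \<exists>U \<in> \<U>. V \<subseteq> U) \<and> locally_finite_in X \<V>" ..
  then show thesis
    by (intro that[of \<V>]) simp_all
qed

text \<open>Each point has a neighbourhood that misses \<open>S\<close> or whose closure misses
  \<open>T\<close>. In a locally finite refinement the members meeting \<open>S\<close> have
  closures missing \<open>T\<close>, and local finiteness lets closure commute with their
  union.\<close>

lemma regular_paracompact_imp_normal_space: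
  assumes reg: "regular_space X" and para: "paracompact_space X"
  shows "normal_space X"
  unfolding normal_space
proof (intro allI impI)
  fix S T assume "closedin X S \<and> closedin X T \<and> disjnt S T"
  then have S: "closedin X S" "S \<subseteq> topspace X" and T: "closedin X T" and ST: "S \<inter> T = {}"
    by (auto simp: closedin_subset disjnt_def)
  define \<U> where "\<U> = {U. openin X U \<and> (U \<inter> S = {} \<or> X closure_of U \<inter> T = {})}"
  have "\<exists>U\<in>\<U>. x \<in> U" if x: "x \<in> topspace X" for x
  proof (cases "x \<in> S")
    case True
    then have "openin X (topspace X - T)" "x \<in> topspace X - T"
      using T ST x by auto
    from regular_space_shrink[OF reg this] obtain V where
      "openin X V" "x \<in> V" "X closure_of V \<subseteq> topspace X - T" by blast
    then show ?thesis
      unfolding \<U>_def by blast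
  next
    case False
    then have "topspace X - S \<in> \<U>" "x \<in> topspace X - S"
      using S x unfolding \<U>_def by auto
    then show ?thesis by blast
  qed
  then have "topspace X \<subseteq> \<Union>\<U>" by blast
  moreover have "\<And>U. U \<in> \<U> \<Longrightarrow> openin X U"
    unfolding \<U>_def by blast
  ultimately obtain \<V> where \<V>: "\<And>V. V \<in> \<V> \<Longrightarrow> openin X V" "\<Union>\<V> = topspace X"
      "\<And>V. V \<in> \<V> \<Longrightarrow> \<exists>U\<in>\<U>. V \<subseteq> U" "locally_finite_in X \<V>"
    using paracompact_space_refinement[OF para, of \<U>] by metis
  define \<V>' where "\<V>' = {V \<in> \<V>. V \<inter> S \<noteq> {}}"
  have "X closure_of V \<inter> T = {}" if V: "V \<in> \<V>'" for V
  proof -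
    obtain U where U: "U \<in> \<U>" "V \<subseteq> U"
      using V \<V>(3) unfolding \<V>'_def by blast
    then have "X closure_of U \<inter> T = {}"
      using V unfolding \<V>'_def \<U>_def by blast
    then show ?thesis
      using closure_of_mono[OF U(2)] by blast
  qed
  moreover have "locally_finite_in X \<V>'"
    by (rule locally_finite_in_subset[OF \<V>(4)]) (auto simp: \<V>'_def)
  ultimately have "disjnt T (X closure_of \<Union>\<V>')"
    by (auto simp: closure_of_locally_finite_Union disjnt_def)
  moreover have "openin X (\<Union>\<V>')"
    using \<V>(1) unfolding \<V>'_def by blast
  moreover have "S \<subseteq> \<Union>\<V>'"
    using S(2) \<V>(2) unfolding \<V>'_def by blast
  ultimately show "\<exists>U. openin X U \<and> S \<subseteq> U \<and> disjnt T (X closure_of U)"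
    by blast
qed

section \<open>Continuous pseudometrics and metrics on paracompact spaces\<close>

text \<open>A substitute for a partition of unity: the functions are not normalised, but every point
  is sent to 1 by one of them. A second refinement shrinks the first, so that Urysohn's lemma
  applies to each member.\<close>

lemma regular_paracompact_Urysohn_family:
  assumes reg: "regular_space X" and para: "paracompact_space X"
    and \<U>: "\<And>U. U \<in> \<U> \<Longrightarrow> openin X U" "topspace X \<subseteq> \<Union>\<U>"
  obtains \<V> and f :: "'a set \<Rightarrow> 'a \<Rightarrow> real" where "locally_finite_in X \<V>"
    "\<And>V. V \<in> \<V> \<Longrightarrow> \<exists>U\<in>\<U>. V \<subseteq> U"
    "\<And>V. V \<in> \<V> \<Longrightarrow> continuous_map X euclideanreal (f V)"
    "\<And>V x. V \<in> \<V> \<Longrightarrow> x \<in> topspace X - V \<Longrightarrow> f V x = 0"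
    "\<And>x. x \<in> topspace X \<Longrightarrow> \<exists>V\<in>\<V>. f V x = 1"
proof -
  obtain \<V> where \<V>: "\<And>V. V \<in> \<V> \<Longrightarrow> openin X V" "\<Union>\<V> = topspace X"
      "\<And>V. V \<in> \<V> \<Longrightarrow> \<exists>U\<in>\<U>. V \<subseteq> U" "locally_finite_in X \<V>"
    using paracompact_space_refinement[OF para \<U>] by metis
  define \<O> where "\<O> = {W. openin X W \<and> (\<exists>V\<in>\<V>. X closure_of W \<subseteq> V)}"
  have "\<exists>W\<in>\<O>. x \<in> W" if x: "x \<in> topspace X" for x
  proof -
    obtain V where V: "V \<in> \<V>" "x \<in> V"
      using \<V>(2) x by blast
    from regular_space_shrink[OF reg \<V>(1)[OF V(1)] V(2)] obtain W
      where "openin X W" "x \<in> W" "X closure_of W \<subseteq> V" by blast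
    then have "W \<in> \<O>"
      using V(1) unfolding \<O>_def by blast
    with \<open>x \<in> W\<close> show ?thesis by blast
  qed
  then have "topspace X \<subseteq> \<Union>\<O>" by blast
  moreover have "\<And>U. U \<in> \<O> \<Longrightarrow> openin X U"
    unfolding \<O>_def by blast
  ultimately obtain \<W> where \<W>: "\<And>V. V \<in> \<W> \<Longrightarrow> openin X V" "\<Union>\<W> = topspace X"
      "\<And>V. V \<in> \<W> \<Longrightarrow> \<exists>U\<in>\<O>. V \<subseteq> U" "locally_finite_in X \<W>"
    using paracompact_space_refinement[OF para, of \<O>] by metis
  \<comment> \<open>Local finiteness of \<open>\<W>\<close> makes \<open>F V\<close> a closed subset
    of \<open>V\<close>; the sets \<open>F V\<close> still cover the space.\<close>
  define F where "F V = \<Union>((\<lambda>W. X closure_of W) ` {W \<in> \<W>. X closure_of W \<subseteq> V})" for V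
  have "\<exists>f. continuous_map X euclideanreal f \<and> f ` (topspace X - V) \<subseteq> {0} \<and> f ` F V \<subseteq> {1::real}"
    if "V \<in> \<V>" for V
  proof -
    have "locally_finite_in X {W \<in> \<W>. X closure_of W \<subseteq> V}"
      by (rule locally_finite_in_subset[OF \<W>(4)]) auto
    then have "closedin X (F V)"
      unfolding F_def by (rule closedin_Union_locally_finite_closure)
    moreover have "closedin X (topspace X - V)" "disjnt (topspace X - V) (F V)"
      using \<V>(1)[OF that] unfolding F_def disjnt_def by blast+
    ultimately show ?thesis
      using Urysohn_lemma_alt[OF regular_paracompact_imp_normal_space[OF reg para]] by metis
  qed
  then have "\<forall>V\<in>\<V>. \<exists>f. continuous_map X euclideanreal f \<and>
      f ` (topspace X - V) \<subseteq> {0} \<and> f ` F V \<subseteq> {1::real}" by blast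
  from bchoice[OF this] obtain f where f: "\<forall>V\<in>\<V>. continuous_map X euclideanreal (f V) \<and>
      f V ` (topspace X - V) \<subseteq> {0} \<and> f V ` F V \<subseteq> {1::real}" ..
  show thesis
  proof (rule that[of \<V> f])
    fix x assume x: "x \<in> topspace X"
    then obtain W where W: "W \<in> \<W>" "x \<in> W"
      using \<W>(2) by blast
    obtain W' where "W' \<in> \<O>" "W \<subseteq> W'"
      using \<W>(3)[OF W(1)] by blast
    then obtain V where V: "V \<in> \<V>" "X closure_of W \<subseteq> V"
      unfolding \<O>_def using closure_of_mono by blast
    have "W \<subseteq> topspace X"
      using \<W>(2) W(1) by blast
    then have "x \<in> X closure_of W"
      using closure_of_subset W(2) by blast
    then have "x \<in> F V"
      unfolding F_def using W(1) V(2) by blast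
    then show "\<exists>V\<in>\<V>. f V x = 1"
      using f V(1) by blast
  qed (use f \<V>(3,4) in \<open>auto simp: image_subset_iff\<close>)
qed

text \<open>The distance sums \<open>\<bar>f V x - f V y\<bar>\<close> over the Urysohn family;
  local finiteness leaves finitely many nonzero terms. At distance 0 the function with value 1 at
  \<open>x\<close> has value 1 at \<open>y\<close> too, so both points lie in the same
  \<open>V\<close>.\<close>

lemma regular_paracompact_continuous_pseudometric:
  assumes reg: "regular_space X" and para: "paracompact_space X"
    and \<U>: "\<And>U. U \<in> \<U> \<Longrightarrow> openin X U" "topspace X \<subseteq> \<Union>\<U>"
  obtains d :: "'a \<Rightarrow> 'a \<Rightarrow> real" where
    "continuous_map (prod_topology X X) euclideanreal (\<lambda>(x, y). d x y)"
    "\<And>x y. 0 \<le> d x y" "\<And>x y. d x y \<le> 1" "\<And>x. d x x = 0" "\<And>x y. d x y = d y x"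
    "\<And>x y z. \<lbrakk>x \<in> topspace X; y \<in> topspace X; z \<in> topspace X\<rbrakk> \<Longrightarrow> d x z \<le> d x y + d y z"
    "\<And>x y. \<lbrakk>x \<in> topspace X; y \<in> topspace X; d x y = 0\<rbrakk> \<Longrightarrow> \<exists>U\<in>\<U>. x \<in> U \<and> y \<in> U"
proof (rule regular_paracompact_Urysohn_family[OF assms])
  fix \<V> and f :: "'a set \<Rightarrow> 'a \<Rightarrow> real"
  assume lf: "locally_finite_in X \<V>" and ref: "\<And>V. V \<in> \<V> \<Longrightarrow> \<exists>U\<in>\<U>. V \<subseteq> U"
    and cont: "\<And>V. V \<in> \<V> \<Longrightarrow> continuous_map X euclideanreal (f V)"
    and supp: "\<And>V x. V \<in> \<V> \<Longrightarrow> x \<in> topspace X - V \<Longrightarrow> f V x = 0"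
    and one: "\<And>x. x \<in> topspace X \<Longrightarrow> \<exists>V\<in>\<V>. f V x = 1"
  define D where "D x y = {V \<in> \<V>. f V x \<noteq> f V y}" for x y
  \<comment> \<open>Outside the space \<open>D x y\<close> may be infinite, and the sum is then 0;
    so sign and symmetry hold for all arguments.\<close>
  define s where "s x y = (\<Sum>V\<in>D x y. \<bar>f V x - f V y\<bar>)" for x y
  have s_eq: "s x y = (\<Sum>V\<in>F. \<bar>f V x - f V y\<bar>)" if "finite F" "D x y \<subseteq> F" "F \<subseteq> \<V>" for x y F
    unfolding s_def using that by (intro sum.mono_neutral_left) (auto simp: D_def)
  have s_nonneg: "0 \<le> s x y" for x y
    unfolding s_def by (simp add: sum_nonneg)
  have s_sym: "s x y = s y x" for x y
  proof -
    have "D x y = D y x"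
      unfolding D_def by auto
    then show ?thesis
      unfolding s_def by (simp add: abs_minus_commute)
  qed
  have local: "\<exists>U. openin X U \<and> x \<in> U \<and> finite {V \<in> \<V>. V \<inter> U \<noteq> {}}" if "x \<in> topspace X" for x
    using lf that unfolding locally_finite_in_def by blast
  have D_sub: "D x y \<subseteq> {V \<in> \<V>. V \<inter> U \<noteq> {}} \<union> {V \<in> \<V>. V \<inter> W \<noteq> {}}"
    if "openin X U" "openin X W" "x \<in> U" "y \<in> W" for x y U W
  proof
    fix V assume V: "V \<in> D x y"
    have xy: "x \<in> topspace X" "y \<in> topspace X"
      using that openin_subset by blast+
    have "V \<in> \<V>" "f V x \<noteq> f V y"
      using V unfolding D_def by auto
    then have "x \<in> V \<or> y \<in> V"
      using supp[of V x] supp[of V y] xy by fastforce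
    with that \<open>V \<in> \<V>\<close> show "V \<in> {V \<in> \<V>. V \<inter> U \<noteq> {}} \<union> {V \<in> \<V>. V \<inter> W \<noteq> {}}"
      by blast
  qed
  have D_fin: "finite (D x y)" if xy: "x \<in> topspace X" "y \<in> topspace X" for x y
  proof -
    obtain U where U: "openin X U" "x \<in> U" "finite {V \<in> \<V>. V \<inter> U \<noteq> {}}"
      using local[OF xy(1)] by blast
    obtain W where W: "openin X W" "y \<in> W" "finite {V \<in> \<V>. V \<inter> W \<noteq> {}}"
      using local[OF xy(2)] by blast
    show ?thesis
      using D_sub[OF U(1) W(1) U(2) W(2)] U(3) W(3) finite_subset by blast
  qed
  have s_tri: "s x z \<le> s x y + s y z"
    if "x \<in> topspace X" "y \<in> topspace X" "z \<in> topspace X" for x y z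
  proof -
    let ?F = "D x z \<union> D x y \<union> D y z"
    have F: "finite ?F" "?F \<subseteq> \<V>"
      using D_fin that by (auto simp: D_def)
    have "s x z = (\<Sum>V\<in>?F. \<bar>f V x - f V z\<bar>)"
      using F by (intro s_eq) auto
    also have "\<dots> \<le> (\<Sum>V\<in>?F. \<bar>f V x - f V y\<bar> + \<bar>f V y - f V z\<bar>)"
      by (intro sum_mono) linarith
    also have "\<dots> = s x y + s y z"
      using F by (subst (1 2) s_eq[of ?F]) (auto simp: sum.distrib)
    finally show ?thesis .
  qed
  have s_cont: "continuous_map (prod_topology X X) euclideanreal (\<lambda>p. s (fst p) (snd p))"
  proof -
    have "\<exists>U. \<forall>x\<in>topspace X. openin X (U x) \<and> x \<in> U x \<and> finite {V \<in> \<V>. V \<inter> U x \<noteq> {}}"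
      using local by metis
    then obtain U where U: "\<And>x. x \<in> topspace X \<Longrightarrow> openin X (U x)"
      "\<And>x. x \<in> topspace X \<Longrightarrow> x \<in> U x"
      "\<And>x. x \<in> topspace X \<Longrightarrow> finite {V \<in> \<V>. V \<inter> U x \<noteq> {}}" by blast
    \<comment> \<open>\<open>F q\<close> is a finite index set that serves all pairs in the
      rectangle around \<open>q\<close>; there \<open>s\<close> equals the finite sum
      \<open>g q\<close>, and continuity follows by pasting.\<close>
    define F where "F q = {V \<in> \<V>. V \<inter> U (fst q) \<noteq> {}} \<union> {V \<in> \<V>. V \<inter> U (snd q) \<noteq> {}}" for q
    define g where "g q = (\<lambda>p. \<Sum>V\<in>F q. \<bar>f V (fst p) - f V (snd p)\<bar>)" for q
    have sg: "s (fst p) (snd p) = g q p"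
      if q: "q \<in> topspace X \<times> topspace X" and p: "p \<in> U (fst q) \<times> U (snd q)" for p q
    proof -
      have q': "fst q \<in> topspace X" "snd q \<in> topspace X" and "fst p \<in> U (fst q)" "snd p \<in> U (snd q)"
        using p q by auto
      then have "D (fst p) (snd p) \<subseteq> F q"
        unfolding F_def using U(1) by (intro D_sub)
      moreover have "finite (F q)" "F q \<subseteq> \<V>"
        unfolding F_def using U(3) q' by auto
      ultimately show ?thesis
        unfolding g_def by (intro s_eq)
    qed
    show ?thesis
    proof (rule pasting_lemma[where I = "topspace X \<times> topspace X" and f = g
            and T = "\<lambda>q. U (fst q) \<times> U (snd q)"])
      fix q assume "q \<in> topspace X \<times> topspace X"
      then show "openin (prod_topology X X) (U (fst q) \<times> U (snd q))"
        using U(1) by (auto simp: openin_prod_Times_iff)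
    next
      fix q assume q: "q \<in> topspace X \<times> topspace X"
      then have fin: "finite (F q)"
        unfolding F_def using U(3) by auto
      have "continuous_map (prod_topology X X) euclideanreal (g q)"
        unfolding g_def
      proof (intro continuous_map_sum fin continuous_map_real_abs continuous_map_diff)
        fix V assume "V \<in> F q"
        then have "V \<in> \<V>"
          unfolding F_def by blast
        from continuous_map_compose[OF continuous_map_fst cont[OF this]]
          continuous_map_compose[OF continuous_map_snd cont[OF this]]
        show "continuous_map (prod_topology X X) euclideanreal (\<lambda>p. f V (fst p))"
          "continuous_map (prod_topology X X) euclideanreal (\<lambda>p. f V (snd p))"
          by (simp_all add: o_def)
      qed
      then show "continuous_map (subtopology (prod_topology X X) (U (fst q) \<times> U (snd q)))
          euclideanreal (g q)"
        by (rule continuous_map_from_subtopology)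
    next
      fix i j p
      assume "i \<in> topspace X \<times> topspace X" "j \<in> topspace X \<times> topspace X"
        "p \<in> topspace (prod_topology X X) \<inter> U (fst i) \<times> U (snd i) \<inter> U (fst j) \<times> U (snd j)"
      then show "g i p = g j p"
        using sg[of i p] sg[of j p] by auto
    next
      fix p assume "p \<in> topspace (prod_topology X X)"
      then have "p \<in> topspace X \<times> topspace X" "p \<in> U (fst p) \<times> U (snd p)"
        using U(2) by (auto simp: mem_Times_iff)
      then show "\<exists>j. j \<in> topspace X \<times> topspace X \<and> p \<in> U (fst j) \<times> U (snd j) \<and>
          s (fst p) (snd p) = g j p"
        using sg by blast
    qed
  qed
  \<comment> \<open>Truncation gives the uniform bound needed to sum countably many
    pseudometrics.\<close>
  define d where "d x y = min 1 (s x y)" for x y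
  show thesis
  proof (rule that[of d])
    have "continuous_map (prod_topology X X) euclideanreal (\<lambda>p. min 1 (s (fst p) (snd p)))"
      using s_cont by (intro continuous_map_real_min) auto
    then show "continuous_map (prod_topology X X) euclideanreal (\<lambda>(x, y). d x y)"
      by (simp add: d_def case_prod_unfold)
  next
    fix x y show "0 \<le> d x y" "d x y \<le> 1" "d x y = d y x"
      unfolding d_def using s_nonneg s_sym by auto
  next
    fix x show "d x x = 0"
      by (simp add: d_def s_def D_def)
  next
    fix x y z assume "x \<in> topspace X" "y \<in> topspace X" "z \<in> topspace X"
    then show "d x z \<le> d x y + d y z"
      using s_tri[of x y z] s_nonneg[of x y] s_nonneg[of y z] unfolding d_def by linarith
  next
    fix x y assume xy: "x \<in> topspace X" "y \<in> topspace X" and "d x y = 0"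
    then have "s x y = 0"
      unfolding d_def by linarith
    then have "\<forall>V\<in>D x y. \<bar>f V x - f V y\<bar> = 0"
      unfolding s_def using D_fin[OF xy] by (subst (asm) sum_nonneg_eq_0_iff) auto
    then have eq: "f V x = f V y" if "V \<in> \<V>" for V
      using that unfolding D_def by auto
    obtain V where V: "V \<in> \<V>" "f V x = 1"
      using one[OF xy(1)] by blast
    then have "f V y = 1"
      using eq[OF V(1)] by simp
    then have "x \<in> V" "y \<in> V"
      using supp[OF V(1), of x] supp[OF V(1), of y] V(2) xy by fastforce+
    then show "\<exists>U\<in>\<U>. x \<in> U \<and> y \<in> U"
      using ref[OF V(1)] by blast
  qed
qed

text \<open>The metric is the series of the \<open>d n\<close> with weights
  \<open>(1/2) ^ n\<close>. The Weierstrass test gives uniform convergence, hence continuity, and a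
  series of nonnegative terms vanishes only if every term does.\<close>

lemma submetrizable_spaceI:
  fixes d :: "nat \<Rightarrow> 'a \<Rightarrow> 'a \<Rightarrow> real"
  assumes cont: "\<And>n. continuous_map (prod_topology X X) euclideanreal (\<lambda>(x, y). d n x y)"
    and nonneg: "\<And>n x y. 0 \<le> d n x y" and le1: "\<And>n x y. d n x y \<le> 1"
    and refl: "\<And>n x. d n x x = 0" and sym: "\<And>n x y. d n x y = d n y x"
    and tri: "\<And>n x y z. \<lbrakk>x \<in> topspace X; y \<in> topspace X; z \<in> topspace X\<rbrakk>
      \<Longrightarrow> d n x z \<le> d n x y + d n y z"
    and sep: "\<And>x y. \<lbrakk>x \<in> topspace X; y \<in> topspace X; \<And>n. d n x y = 0\<rbrakk> \<Longrightarrow> x = y"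
  shows "submetrizable_space X"
proof -
  define t where "t n x y = (1/2) ^ n * d n x y" for n x y
  define \<rho> where "\<rho> x y = (\<Sum>n. t n x y)" for x y
  have t_le: "norm (t n x y) \<le> (1/2) ^ n" for n x y
    unfolding t_def using nonneg[of n x y] le1[of n x y] by (simp add: abs_mult mult_left_le)
  have t_nonneg: "0 \<le> t n x y" for n x y
    unfolding t_def by (simp add: nonneg)
  have geo: "summable (\<lambda>n. (1/2::real) ^ n)"
    by (intro summable_geometric) simp
  have summ: "summable (\<lambda>n. t n x y)" for x y
    by (rule summable_comparison_test'[OF geo]) (use t_le in auto)
  have "Metric_space (topspace X) \<rho>"
  proof
    fix x y
    show "0 \<le> \<rho> x y"
      unfolding \<rho>_def by (intro suminf_nonneg summ t_nonneg)
    show "\<rho> x y = \<rho> y x"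
      unfolding \<rho>_def t_def by (subst sym) simp
  next
    fix x y assume xy: "x \<in> topspace X" "y \<in> topspace X"
    show "\<rho> x y = 0 \<longleftrightarrow> x = y"
    proof
      assume "\<rho> x y = 0"
      then have "t n x y = 0" for n
        unfolding \<rho>_def using suminf_eq_zero_iff[OF summ] t_nonneg by blast
      then have "d n x y = 0" for n
        unfolding t_def by auto
      then show "x = y"
        using sep[OF xy] by blast
    next
      assume "x = y"
      then show "\<rho> x y = 0"
        by (simp add: \<rho>_def t_def refl)
    qed
  next
    fix x y z assume xyz: "x \<in> topspace X" "y \<in> topspace X" "z \<in> topspace X"
    have "\<rho> x z \<le> (\<Sum>n. t n x y + t n y z)"
      unfolding \<rho>_def
    proof (intro suminf_le summ summable_add)
      fix n
      have "t n x z \<le> (1/2) ^ n * (d n x y + d n y z)"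
        unfolding t_def by (intro mult_left_mono tri xyz) simp
      then show "t n x z \<le> t n x y + t n y z"
        by (simp add: t_def distrib_left)
    qed
    also have "\<dots> = \<rho> x y + \<rho> y z"
      unfolding \<rho>_def by (intro suminf_add[symmetric] summ)
    finally show "\<rho> x z \<le> \<rho> x y + \<rho> y z" .
  qed
  moreover have "continuous_map (prod_topology X X) euclideanreal (\<lambda>(x, y). \<rho> x y)"
  proof -
    let ?S = "topspace (prod_topology X X)"
    have lim: "uniform_limit ?S (\<lambda>n p. \<Sum>i<n. t i (fst p) (snd p))
        (\<lambda>p. \<Sum>i. t i (fst p) (snd p)) sequentially"
      by (rule Weierstrass_m_test[OF _ geo]) (rule t_le)
    have "continuous_map (prod_topology X X) Met_TC.mtopology
        (\<lambda>p. \<Sum>i. t i (fst p) (snd p))"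
    proof (rule Met_TC.continuous_map_uniform_limit)
      have "continuous_map (prod_topology X X) euclideanreal (\<lambda>p. t i (fst p) (snd p))" for i
        unfolding t_def using cont[of i]
        by (intro continuous_map_real_mult_left) (simp add: case_prod_unfold)
      then have "continuous_map (prod_topology X X) euclideanreal
          (\<lambda>p. \<Sum>i<n. t i (fst p) (snd p))" for n
        by (intro continuous_map_sum) auto
      then show "\<forall>\<^sub>F n in sequentially. continuous_map (prod_topology X X) Met_TC.mtopology
          (\<lambda>p. \<Sum>i<n. t i (fst p) (snd p))"
        by simp
    next
      fix \<epsilon> :: real assume "\<epsilon> > 0"
      from uniform_limitD[OF lim this]
      show "\<forall>\<^sub>F n in sequentially. \<forall>p\<in>?S. (\<Sum>i. t i (fst p) (snd p)) \<in> UNIV \<and>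
          dist (\<Sum>i<n. t i (fst p) (snd p)) (\<Sum>i. t i (fst p) (snd p)) < \<epsilon>"
        by simp
    qed simp
    then show ?thesis
      by (simp add: \<rho>_def case_prod_unfold)
  qed
  ultimately show ?thesis
    unfolding submetrizable_space_def by blast
qed

text \<open>Each cover yields a pseudometric for which points at distance 0 share a member of the
  cover; as the covers together separate points, so do the pseudometrics.\<close>

lemma regular_paracompact_imp_submetrizable:
  fixes \<U> :: "nat \<Rightarrow> 'a set set"
  assumes reg: "regular_space X" and para: "paracompact_space X"
    and \<U>: "\<And>n U. U \<in> \<U> n \<Longrightarrow> openin X U" "\<And>n. topspace X \<subseteq> \<Union>(\<U> n)"
    and sep: "\<And>x y. \<lbrakk>x \<in> topspace X; y \<in> topspace X; \<And>n. \<exists>U\<in>\<U> n. x \<in> U \<and> y \<in> U\<rbrakk> \<Longrightarrow> x = y"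
  shows "submetrizable_space X"
proof -
  define P where "P n d \<longleftrightarrow>
    continuous_map (prod_topology X X) euclideanreal (\<lambda>(x, y). d x y) \<and>
    (\<forall>x y. 0 \<le> d x y \<and> d x y \<le> (1::real) \<and> d x x = 0 \<and> d x y = d y x) \<and>
    (\<forall>x\<in>topspace X. \<forall>y\<in>topspace X. \<forall>z\<in>topspace X. d x z \<le> d x y + d y z) \<and>
    (\<forall>x\<in>topspace X. \<forall>y\<in>topspace X. d x y = 0 \<longrightarrow> (\<exists>U\<in>\<U> n. x \<in> U \<and> y \<in> U))" for n d
  have "\<forall>n. \<exists>d. P n d"
  proof
    fix n
    show "\<exists>d. P n d"
    proof (rule regular_paracompact_continuous_pseudometric[OF reg para \<U>(1) \<U>(2)[of n]])
      fix d :: "'a \<Rightarrow> 'a \<Rightarrow> real"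
      assume "continuous_map (prod_topology X X) euclideanreal (\<lambda>(x, y). d x y)"
        "\<And>x y. 0 \<le> d x y" "\<And>x y. d x y \<le> 1" "\<And>x. d x x = 0" "\<And>x y. d x y = d y x"
        "\<And>x y z. \<lbrakk>x \<in> topspace X; y \<in> topspace X; z \<in> topspace X\<rbrakk>
          \<Longrightarrow> d x z \<le> d x y + d y z"
        "\<And>x y. \<lbrakk>x \<in> topspace X; y \<in> topspace X; d x y = 0\<rbrakk> \<Longrightarrow> \<exists>U\<in>\<U> n. x \<in> U \<and> y \<in> U"
      then have "P n d" by (simp add: P_def)
      then show "\<exists>d. P n d" by (intro exI[of _ d])
    qed
  qed
  from choice[OF this] obtain d where d: "\<forall>n. P n (d n)" ..
  note d = d[unfolded P_def]
  show ?thesis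
  proof (rule submetrizable_spaceI[of X d])
    fix x y assume "x \<in> topspace X" "y \<in> topspace X" "\<And>n. d n x y = 0"
    then show "x = y"
      using d by (intro sep) auto
  qed (use d in auto)
qed

text \<open>M. E. Rudin's proof that metrizable spaces are paracompact does not need a metric. The
  relations \<open>E n\<close> replace \<open>dist x y < 2 powr - n\<close>; instead of the triangle inequality, only its
  local form \<open>small\<close> is available.\<close>

lemma entourages_imp_paracompact:
  fixes E :: "nat \<Rightarrow> 'a \<Rightarrow> 'a \<Rightarrow> bool"
  assumes haus: "Hausdorff_space X"
    and E_in: "\<And>n x y. E n x y \<Longrightarrow> y \<in> topspace X"
    and E_refl: "\<And>n x. x \<in> topspace X \<Longrightarrow> E n x x"
    and E_sym: "\<And>n x y. E n x y \<Longrightarrow> E n y x"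
    and E_dec: "\<And>m n x y. m \<le> n \<Longrightarrow> E n x y \<Longrightarrow> E m x y"
    and E_open: "\<And>n x. openin X {y. E n x y}"
    and E_diag: "\<And>n x. x \<in> topspace X \<Longrightarrow>
      \<exists>V. openin X V \<and> x \<in> V \<and> (\<forall>p\<in>V. \<forall>q\<in>V. E n p q)"
    and small: "\<And>x U. openin X U \<Longrightarrow> x \<in> U \<Longrightarrow>
      \<exists>n V. openin X V \<and> x \<in> V \<and> (\<forall>y\<in>V. \<forall>z. E n y z \<longrightarrow> z \<in> U)"
  shows "paracompact_space X"
  unfolding paracompact_space_def
proof (intro conjI haus allI impI)
  fix \<U> assume "(\<forall>U \<in> \<U>. openin X U) \<and> \<Union>\<U> = topspace X"
  then have \<U>_open: "\<And>U. U \<in> \<U> \<Longrightarrow> openin X U" and \<U>_cov: "\<Union>\<U> = topspace X" by auto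
  \<comment> \<open>Well-ordering all sets gives each point \<open>x\<close> a least member
    \<open>c x\<close> of \<open>\<U>\<close> that contains it.\<close>
  obtain r :: "('a set) rel" where r: "well_order_on UNIV r"
    using well_ordering by metis
  have wf: "wf (r - Id)" and tot: "total r"
    using r by (auto simp: well_order_on_def linear_order_on_def)
  have "\<exists>U. U \<in> \<U> \<and> x \<in> U \<and> (\<forall>V. (V, U) \<in> r - Id \<longrightarrow> \<not> (V \<in> \<U> \<and> x \<in> V))"
    if "x \<in> topspace X" for x
  proof -
    obtain U where "U \<in> {U \<in> \<U>. x \<in> U}"
      using \<open>x \<in> topspace X\<close> \<U>_cov by blast
    from wfE_min[OF wf this] show ?thesis by (metis (no_types, lifting) mem_Collect_eq)
  qed
  then have "\<forall>x\<in>topspace X. \<exists>U. U \<in> \<U> \<and> x \<in> U \<and>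
      (\<forall>V. (V, U) \<in> r - Id \<longrightarrow> \<not> (V \<in> \<U> \<and> x \<in> V))" by blast
  from bchoice[OF this] obtain c where c: "\<forall>x\<in>topspace X. c x \<in> \<U> \<and> x \<in> c x \<and>
      (\<forall>V. (V, c x) \<in> r - Id \<longrightarrow> \<not> (V \<in> \<U> \<and> x \<in> V))" ..
  \<comment> \<open>In \<open>unique\<close> the three steps lead from a centre to \<open>p\<close>,
    from \<open>p\<close> to \<open>q\<close>, and from \<open>q\<close> to another centre.\<close>
  define Q where "Q n x \<longleftrightarrow> (\<forall>p q z. E n x p \<and> E n p q \<and> E n q z \<longrightarrow> z \<in> c x)" for n x
  have Q_ex: "\<exists>n. Q n x" if x: "x \<in> topspace X" for x
  proof -
    have "openin X (c x)" "x \<in> c x"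
      using c x \<U>_open by auto
    from small[OF this] obtain n1 V1 where 1: "openin X V1" "x \<in> V1"
      "\<forall>y\<in>V1. \<forall>z. E n1 y z \<longrightarrow> z \<in> c x" by blast
    from small[OF 1(1,2)] obtain n2 V2 where 2: "openin X V2" "x \<in> V2"
      "\<forall>y\<in>V2. \<forall>z. E n2 y z \<longrightarrow> z \<in> V1" by blast
    from small[OF 2(1,2)] obtain n3 V3 where 3: "openin X V3" "x \<in> V3"
      "\<forall>y\<in>V3. \<forall>z. E n3 y z \<longrightarrow> z \<in> V2" by blast
    define n where "n = max n1 (max n2 n3)"
    have "n1 \<le> n" "n2 \<le> n" "n3 \<le> n"
      unfolding n_def by auto
    then have "Q n x"
      unfolding Q_def using 1 2 3 E_dec by meson
    then show ?thesis ..
  qed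
  \<comment> \<open>Stage \<open>n\<close> takes as centres only points missed by all earlier
    stages, hence the recursion along \<open>less_than\<close>. \<open>G n\<close> is what stage
    \<open>n\<close> covers, and \<open>D n C\<close> below is the part whose centres are assigned
    to \<open>C\<close>.\<close>
  have "\<exists>G. \<forall>n. G n = {y. \<exists>x\<in>topspace X. Q n x \<and> (\<forall>j<n. x \<notin> G j) \<and> E n x y}"
    by (rule dependent_wf_choice[of less_than]) auto
  then obtain G where G: "\<And>n. G n = {y. \<exists>x\<in>topspace X. Q n x \<and> (\<forall>j<n. x \<notin> G j) \<and> E n x y}"
    by blast
  define D where "D n C = {y. \<exists>x\<in>topspace X. c x = C \<and> Q n x \<and> (\<forall>j<n. x \<notin> G j) \<and> E n x y}"
    for n C
  have D_open: "openin X (D n C)" for n C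
  proof -
    have "D n C = \<Union>((\<lambda>x. {y. E n x y}) ` {x \<in> topspace X. c x = C \<and> Q n x \<and> (\<forall>j<n. x \<notin> G j)})"
      unfolding D_def by auto
    moreover have "openin X \<dots>"
      by (rule openin_Union) (auto intro: E_open)
    ultimately show ?thesis by simp
  qed
  have D_G: "D n C \<subseteq> G n" for n C
    unfolding D_def by (subst G) blast
  have G_D: "\<exists>C\<in>\<U>. y \<in> D n C" if "y \<in> G n" for y n
    using that c unfolding D_def by (subst (asm) G) blast
  have D_sub: "D n C \<subseteq> C" for n C
  proof
    fix y assume "y \<in> D n C"
    then obtain x where "x \<in> topspace X" "c x = C" "Q n x" "E n x y"
      unfolding D_def by blast
    then show "y \<in> C"
      unfolding Q_def using E_refl E_in by blast
  qed
  have cover: "\<exists>n. \<exists>C\<in>\<U>. x \<in> D n C" if x: "x \<in> topspace X" for x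
  proof -
    obtain n where n: "Q n x"
      using Q_ex[OF x] ..
    show ?thesis
    proof (cases "\<exists>j<n. x \<in> G j")
      case True
      then show ?thesis using G_D by blast
    next
      case False
      then have "x \<in> D n (c x)"
        unfolding D_def using x n E_refl by blast
      then show ?thesis using c x by blast
    qed
  qed
  \<comment> \<open>If \<open>C1\<close> preceded \<open>C2\<close>, the chain from \<open>x\<close>
    over \<open>p\<close> and \<open>q\<close> to the centre \<open>y\<close> would place
    \<open>y\<close> in \<open>C1\<close>, against the minimality of
    \<open>c y = C2\<close>.\<close>
  have unique: "C1 = C2"
    if p: "p \<in> D i C1" and q: "q \<in> D i C2" and pq: "E i p q" for p q i C1 C2
  proof -
    have no: "(C1, C2) \<notin> r - Id"
      if p: "p \<in> D i C1" and q: "q \<in> D i C2" and pq: "E i p q" for p q C1 C2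
    proof
      assume less: "(C1, C2) \<in> r - Id"
      obtain x where x: "x \<in> topspace X" "c x = C1" "Q i x" "E i x p"
        using p unfolding D_def by blast
      obtain y where y: "y \<in> topspace X" "c y = C2" "E i y q"
        using q unfolding D_def by blast
      have "y \<in> C1"
        using x(2,3,4) pq E_sym[OF y(3)] unfolding Q_def by blast
      moreover have "C1 \<in> \<U>"
        using c x(1,2) by blast
      ultimately show False
        using c y(1,2) less by blast
    qed
    from no[OF p q pq] no[OF q p E_sym[OF pq]] show ?thesis
      using tot unfolding total_on_def by blast
  qed
  define \<V> where "\<V> = {D n C |n C. C \<in> \<U>}"
  have "locally_finite_in X \<V>"
    unfolding locally_finite_in_def
  proof (intro conjI ballI)
    show "\<Union>\<V> \<subseteq> topspace X"
      unfolding \<V>_def using D_open openin_subset by blast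
    fix z assume z: "z \<in> topspace X"
    obtain n C where nC: "z \<in> D n C"
      using cover[OF z] by blast
    from small[OF D_open nC] obtain m V where V: "openin X V" "z \<in> V"
      "\<forall>y\<in>V. \<forall>x. E m y x \<longrightarrow> x \<in> D n C" by blast
    define k where "k = max m (Suc n)"
    \<comment> \<open>A centre of stage \<open>i\<close> that is \<open>E m\<close>-close to a point
      of \<open>V\<close> would lie in \<open>D n C\<close>, hence in \<open>G n\<close>, which the
      centres of stages after \<open>n\<close> avoid.\<close>
    have late: "D i C' \<inter> V = {}" if i: "i \<ge> k" for i C'
    proof (rule ccontr)
      assume "D i C' \<inter> V \<noteq> {}"
      then obtain y x where y: "y \<in> V" and x: "\<forall>j<i. x \<notin> G j" "E i x y"
        unfolding D_def by blast
      have "m \<le> i" "n < i"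
        using i unfolding k_def by auto
      then have "E m y x"
        using E_dec E_sym[OF x(2)] by blast
      then have "x \<in> D n C"
        using V(3) y by blast
      then show False
        using D_G x(1) \<open>n < i\<close> by blast
    qed
    have "\<forall>i. \<exists>W. openin X W \<and> z \<in> W \<and> (\<forall>p\<in>W. \<forall>q\<in>W. E i p q)"
      using E_diag[OF z] by blast
    from choice[OF this] obtain W where W: "\<And>i. openin X (W i)" "\<And>i. z \<in> W i"
      "\<And>i p q. p \<in> W i \<Longrightarrow> q \<in> W i \<Longrightarrow> E i p q" by blast
    \<comment> \<open>The remaining stages \<open>i < k\<close> contribute at most one set each: any
      two points of \<open>Z\<close> are \<open>E i\<close>-close, and \<open>unique\<close>
      applies.\<close>
    define Z where "Z = V \<inter> \<Inter>(W ` {..k})"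
    have Z: "openin X Z" "z \<in> Z"
      unfolding Z_def using V W by (auto intro!: openin_Int openin_Inter)
    have "{U \<in> \<V>. U \<inter> Z \<noteq> {}} \<subseteq> (\<Union>i<k. {D i C |C. C \<in> \<U> \<and> D i C \<inter> Z \<noteq> {}})"
    proof
      fix U assume U: "U \<in> {U \<in> \<V>. U \<inter> Z \<noteq> {}}"
      then obtain i C' where iC: "U = D i C'" "C' \<in> \<U>"
        unfolding \<V>_def by blast
      then have "i < k"
        using late[of i C'] U unfolding Z_def by (cases "i < k") auto
      then show "U \<in> (\<Union>i<k. {D i C |C. C \<in> \<U> \<and> D i C \<inter> Z \<noteq> {}})"
        using iC U by blast
    qed
    moreover have "finite {D i C |C. C \<in> \<U> \<and> D i C \<inter> Z \<noteq> {}}" if i: "i < k" for i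
    proof -
      have "C1 = C2" if "D i C1 \<inter> Z \<noteq> {}" "D i C2 \<inter> Z \<noteq> {}" for C1 C2
      proof -
        obtain p q where "p \<in> D i C1" "p \<in> Z" "q \<in> D i C2" "q \<in> Z"
          using \<open>D i C1 \<inter> Z \<noteq> {}\<close> \<open>D i C2 \<inter> Z \<noteq> {}\<close> by blast
        moreover then have "E i p q"
          using i W(3) unfolding Z_def by auto
        ultimately show ?thesis
          using unique by blast
      qed
      then have "\<exists>C0. {D i C |C. C \<in> \<U> \<and> D i C \<inter> Z \<noteq> {}} \<subseteq> {D i C0}"
        by blast
      then show ?thesis
        using finite_subset by blast
    qed
    then have "finite (\<Union>i<k. {D i C |C. C \<in> \<U> \<and> D i C \<inter> Z \<noteq> {}})"
      by blast
    ultimately have "finite {U \<in> \<V>. U \<inter> Z \<noteq> {}}"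
      by (rule finite_subset)
    with Z show "\<exists>V. openin X V \<and> z \<in> V \<and> finite {U \<in> \<V>. U \<inter> V \<noteq> {}}"
      by blast
  qed
  moreover have "\<forall>V\<in>\<V>. openin X V" "\<forall>V\<in>\<V>. \<exists>U\<in>\<U>. V \<subseteq> U"
    unfolding \<V>_def using D_open D_sub by blast+
  moreover have "\<Union>\<V> = topspace X"
  proof
    show "\<Union>\<V> \<subseteq> topspace X"
      unfolding \<V>_def using D_open openin_subset by blast
    show "topspace X \<subseteq> \<Union>\<V>"
      unfolding \<V>_def using cover by blast
  qed
  ultimately show "\<exists>\<V>. (\<forall>V \<in> \<V>. openin X V) \<and> \<Union>\<V> = topspace X \<and>
      (\<forall>V \<in> \<V>. \<exists>U \<in> \<U>. V \<subseteq> U) \<and> locally_finite_in X \<V>"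
    by blast
qed

section \<open>Paracompactness from countable networks\<close>

text \<open>Only those network members are kept that fit into an open \<open>V\<close> with closure
  inside a member of \<open>\<U>\<close>. By regularity they still cover \<open>P\<close>, and one
  pair \<open>(U, V)\<close> is chosen for each.\<close>

lemma countable_network_shrinking_sequence:
  assumes reg: "regular_space X" and net: "has_countable_network X P" and P: "P \<noteq> {}"
    "P \<subseteq> topspace X"
    and \<U>: "\<And>U. U \<in> \<U> \<Longrightarrow> openin X U" "topspace X \<subseteq> \<Union>\<U>"
  obtains U V :: "nat \<Rightarrow> 'a set" where "\<And>n. U n \<in> \<U>" "\<And>n. openin X (V n)"
    "\<And>n. X closure_of V n \<subseteq> U n" "P \<subseteq> (\<Union>n. V n)"
proof -
  obtain \<W> where \<W>: "countable \<W>"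
    "\<And>x U. x \<in> P \<Longrightarrow> openin X U \<Longrightarrow> x \<in> U \<Longrightarrow> \<exists>W\<in>\<W>. x \<in> W \<and> W \<subseteq> U"
    using net unfolding has_countable_network_def by meson
  define good where "good W p \<longleftrightarrow> fst p \<in> \<U> \<and> openin X (snd p) \<and>
    X closure_of (snd p) \<subseteq> fst p \<and> W \<subseteq> snd p" for W p
  define \<W>' where "\<W>' = {W \<in> \<W>. \<exists>p. good W p}"
  have ex: "\<exists>W\<in>\<W>'. x \<in> W" if x: "x \<in> P" for x
  proof -
    obtain U where U: "U \<in> \<U>" "x \<in> U"
      using x P(2) \<U>(2) by blast
    from regular_space_shrink[OF reg \<U>(1)[OF U(1)] U(2)] obtain V
      where V: "openin X V" "x \<in> V" "X closure_of V \<subseteq> U" by blast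
    obtain W where W: "W \<in> \<W>" "x \<in> W" "W \<subseteq> V"
      using \<W>(2)[OF x V(1,2)] by blast
    then have "good W (U, V)"
      using U V unfolding good_def by simp
    then show ?thesis
      using W unfolding \<W>'_def by blast
  qed
  have ne: "\<W>' \<noteq> {}"
    using ex P(1) by blast
  have "countable \<W>'"
    using \<W>(1) unfolding \<W>'_def by simp
  have "\<forall>W\<in>\<W>'. \<exists>p. good W p"
    unfolding \<W>'_def by blast
  from bchoice[OF this] obtain p where p: "\<forall>W\<in>\<W>'. good W (p W)" ..
  define W where "W = from_nat_into \<W>'"
  have W: "good (W n) (p (W n))" for n
    using p from_nat_into[OF ne] unfolding W_def by blast
  show thesis
  proof (rule that[of "\<lambda>n. fst (p (W n))" "\<lambda>n. snd (p (W n))"])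
    show "P \<subseteq> (\<Union>n. snd (p (W n)))"
    proof
      fix x assume "x \<in> P"
      then obtain W0 where "W0 \<in> \<W>'" "x \<in> W0"
        using ex by blast
      moreover then obtain n where "W n = W0"
        using from_nat_into_surj[OF \<open>countable \<W>'\<close>] unfolding W_def by blast
      ultimately show "x \<in> (\<Union>n. snd (p (W n)))"
        using W[of n] unfolding good_def by blast
    qed
  qed (use W in \<open>auto simp: good_def\<close>)
qed

text \<open>Well-ordering the points and removing earlier sets from each \<open>H x\<close> gives a
  partition into clopen sets. Inside each part a countable network turns the cover into a sequence,
  which becomes locally finite once the closures of earlier members are removed.\<close>

lemma clopen_cover_imp_paracompact:
  fixes H :: "'a \<Rightarrow> 'a set"
  assumes reg: "regular_space X" and haus: "Hausdorff_space X"
    and H_in: "\<And>x. x \<in> topspace X \<Longrightarrow> x \<in> H x"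
    and H_net: "\<And>x. x \<in> topspace X \<Longrightarrow> has_countable_network X (H x)"
    and H_open: "\<And>I. I \<subseteq> topspace X \<Longrightarrow> openin X (\<Union>x\<in>I. H x)"
    and H_closed: "\<And>I. I \<subseteq> topspace X \<Longrightarrow> closedin X (\<Union>x\<in>I. H x)"
  shows "paracompact_space X"
  unfolding paracompact_space_def
proof (intro conjI haus allI impI)
  fix \<U> assume "(\<forall>U \<in> \<U>. openin X U) \<and> \<Union>\<U> = topspace X"
  then have \<U>: "\<And>U. U \<in> \<U> \<Longrightarrow> openin X U" "topspace X \<subseteq> \<Union>\<U>" by auto
  obtain r :: "'a rel" where r: "well_order_on UNIV r"
    using well_ordering by metis
  have wf: "wf (r - Id)" and tot: "total r"
    using r by (auto simp: well_order_on_def linear_order_on_def)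
  \<comment> \<open>There may be infinitely many predecessors \<open>y\<close>; openness of
    \<open>P x\<close> rests on arbitrary unions of the \<open>H y\<close> being closed.\<close>
  define P where "P x = H x - (\<Union>y\<in>{y \<in> topspace X. (y, x) \<in> r - Id}. H y)" for x
  have P_open: "openin X (P x)" if "x \<in> topspace X" for x
    unfolding P_def using H_open[of "{x}"] that by (intro openin_diff H_closed) auto
  have P_sub: "P x \<subseteq> topspace X" if "x \<in> topspace X" for x
    using P_open[OF that] by (rule openin_subset)
  have P_ex: "\<exists>x\<in>topspace X. z \<in> P x" if z: "z \<in> topspace X" for z
  proof -
    have "z \<in> {x \<in> topspace X. z \<in> H x}"
      using H_in z by blast
    from wfE_min[OF wf this] obtain x where "x \<in> {x \<in> topspace X. z \<in> H x}"
      "\<And>y. (y, x) \<in> r - Id \<Longrightarrow> y \<notin> {x \<in> topspace X. z \<in> H x}" by blast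
    then show ?thesis
      unfolding P_def by blast
  qed
  have P_uniq: "x = y" if "x \<in> topspace X" "y \<in> topspace X" "z \<in> P x" "z \<in> P y" for x y z
  proof -
    have "(x, y) \<notin> r - Id" "(y, x) \<notin> r - Id"
      using that unfolding P_def by blast+
    then show ?thesis
      using tot unfolding total_on_def by blast
  qed
  have "\<exists>p. (\<forall>n. fst (p n) \<in> \<U> \<and> openin X (snd (p n)) \<and> X closure_of (snd (p n)) \<subseteq> fst (p n)) \<and>
      P x \<subseteq> (\<Union>n::nat. snd (p n))" if x: "x \<in> topspace X" for x
  proof (rule countable_network_shrinking_sequence[OF reg H_net[OF x] _ _ \<U>])
    show "H x \<noteq> {}"
      using H_in x by blast
    show "H x \<subseteq> topspace X"
      using openin_subset[OF H_open[of "{x}"]] x by auto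
    fix U V :: "nat \<Rightarrow> 'a set"
    assume "\<And>n. U n \<in> \<U>" "\<And>n. openin X (V n)" "\<And>n. X closure_of V n \<subseteq> U n" "H x \<subseteq> (\<Union>n. V n)"
    then show ?thesis
      by (intro exI[of _ "\<lambda>n. (U n, V n)"]) (auto simp: P_def)
  qed
  then have "\<forall>x\<in>topspace X. \<exists>p. (\<forall>n. fst (p n) \<in> \<U> \<and> openin X (snd (p n)) \<and>
      X closure_of (snd (p n)) \<subseteq> fst (p n)) \<and> P x \<subseteq> (\<Union>n::nat. snd (p n))" by blast
  from bchoice[OF this] obtain p where p: "\<forall>x\<in>topspace X. (\<forall>n. fst (p x n) \<in> \<U> \<and>
      openin X (snd (p x n)) \<and> X closure_of (snd (p x n)) \<subseteq> fst (p x n)) \<and>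
      P x \<subseteq> (\<Union>n::nat. snd (p x n))" ..
  define U where "U x n = fst (p x n)" for x n
  define V where "V x n = snd (p x n)" for x n
  have U: "U x n \<in> \<U>" and V: "openin X (V x n)" "X closure_of (V x n) \<subseteq> U x n"
    and PV: "P x \<subseteq> (\<Union>n. V x n)" if "x \<in> topspace X" for x n
    using p that unfolding U_def V_def by auto
  have VU: "V x n \<subseteq> X closure_of (V x n)" if "x \<in> topspace X" for x n
    by (intro closure_of_subset openin_subset V(1) that)
  \<comment> \<open>The least \<open>n\<close> with \<open>z\<close> in the closure of
    \<open>V x n\<close> puts \<open>z\<close> into \<open>W x n\<close>; conversely, the
    neighbourhood \<open>V x n \<inter> P x\<close> meets only sets \<open>W x m\<close> with
    \<open>m \<le> n\<close>.\<close>
  define W where "W x n = (U x n - (\<Union>i\<in>{..<n}. X closure_of (V x i))) \<inter> P x" for x n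
  have W_open: "openin X (W x n)" if "x \<in> topspace X" for x n
    unfolding W_def using U[OF that] \<U>(1) P_open[OF that]
    by (intro openin_Int openin_diff closedin_Union) auto
  have W_ex: "\<exists>n. z \<in> W x n" if x: "x \<in> topspace X" and z: "z \<in> P x" for x z
  proof -
    have "\<exists>n. z \<in> X closure_of (V x n)"
      using PV[OF x] VU[OF x] z by blast
    from exists_least_iff[THEN iffD1, OF this] obtain n
      where "z \<in> X closure_of (V x n)" "\<forall>i<n. z \<notin> X closure_of (V x i)" by blast
    then show ?thesis
      unfolding W_def using V(2)[OF x] z by blast
  qed
  define \<V> where "\<V> = {W x n |x n. x \<in> topspace X}"
  have W_sub: "W x n \<subseteq> topspace X" if "x \<in> topspace X" for x n
    using W_open[OF that] by (rule openin_subset)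
  have "locally_finite_in X \<V>"
    unfolding locally_finite_in_def
  proof (intro conjI ballI)
    show "\<Union>\<V> \<subseteq> topspace X"
      unfolding \<V>_def using W_sub by blast
    fix z assume "z \<in> topspace X"
    then obtain x where x: "x \<in> topspace X" "z \<in> P x"
      using P_ex by blast
    obtain n where n: "z \<in> V x n"
      using PV[OF x(1)] x(2) by blast
    have "{T \<in> \<V>. T \<inter> (V x n \<inter> P x) \<noteq> {}} \<subseteq> W x ` {..n}"
    proof
      fix T assume T: "T \<in> {T \<in> \<V>. T \<inter> (V x n \<inter> P x) \<noteq> {}}"
      then obtain y m where ym: "T = W y m" "y \<in> topspace X"
        unfolding \<V>_def by blast
      from T obtain q where q: "q \<in> W y m" "q \<in> V x n" "q \<in> P x"
        using ym by blast
      then have "y = x"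
        using P_uniq[OF ym(2) x(1)] unfolding W_def by blast
      have "\<not> n < m"
      proof
        assume "n < m"
        moreover have "q \<in> X closure_of (V x n)"
          using VU[OF x(1)] q(2) by blast
        ultimately show False
          using q(1) unfolding W_def \<open>y = x\<close> by blast
      qed
      then show "T \<in> W x ` {..n}"
        using ym \<open>y = x\<close> by auto
    qed
    then have "finite {T \<in> \<V>. T \<inter> (V x n \<inter> P x) \<noteq> {}}"
      by (rule finite_subset) simp
    moreover have "openin X (V x n \<inter> P x)" "z \<in> V x n \<inter> P x"
      using V(1) P_open x n by auto
    ultimately show "\<exists>T. openin X T \<and> z \<in> T \<and> finite {U \<in> \<V>. U \<inter> T \<noteq> {}}"
      by blast
  qed
  moreover have "\<forall>T\<in>\<V>. openin X T"
    unfolding \<V>_def using W_open by blast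
  moreover have "\<forall>T\<in>\<V>. \<exists>U\<in>\<U>. T \<subseteq> U"
    unfolding \<V>_def W_def using U by blast
  moreover have "\<Union>\<V> = topspace X"
  proof
    show "\<Union>\<V> \<subseteq> topspace X"
      unfolding \<V>_def using W_sub by blast
    show "topspace X \<subseteq> \<Union>\<V>"
    proof
      fix z assume "z \<in> topspace X"
      then obtain x where "x \<in> topspace X" "z \<in> P x"
        using P_ex by blast
      then show "z \<in> \<Union>\<V>"
        using W_ex unfolding \<V>_def by blast
    qed
  qed
  ultimately show "\<exists>\<V>. (\<forall>V \<in> \<V>. openin X V) \<and> \<Union>\<V> = topspace X \<and>
      (\<forall>V \<in> \<V>. \<exists>U \<in> \<U>. V \<subseteq> U) \<and> locally_finite_in X \<V>"
    by blast
qed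

section \<open>Rectifiable spaces\<close>

text \<open>In the notation of the paper, \<open>h (x, y) = (x, mu x y)\<close> and
  \<open>h\<inverse> (x, z) = (x, dl x z)\<close>; in a topological group these would be \<open>x * y\<close> and
  \<open>x\<inverse> * z\<close>. The normalisation \<open>dl e y = y\<close> is no loss of generality.\<close>

locale rectified_space =
  fixes X :: "'a topology" and e :: 'a and mu dl :: "'a \<Rightarrow> 'a \<Rightarrow> 'a"
  assumes reg: "regular_space X" and t1: "t1_space X"
    and e_in: "e \<in> topspace X"
    and cont_mu: "continuous_map (prod_topology X X) X (\<lambda>(x, y). mu x y)"
    and cont_dl: "continuous_map (prod_topology X X) X (\<lambda>(x, y). dl x y)"
    and mu_e: "x \<in> topspace X \<Longrightarrow> mu x e = x"
    and dl_self: "x \<in> topspace X \<Longrightarrow> dl x x = e"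
    and mu_dl: "x \<in> topspace X \<Longrightarrow> y \<in> topspace X \<Longrightarrow> mu x (dl x y) = y"
    and dl_mu: "x \<in> topspace X \<Longrightarrow> y \<in> topspace X \<Longrightarrow> dl x (mu x y) = y"
    and dl_e: "x \<in> topspace X \<Longrightarrow> dl e x = x"

text \<open>The second coordinates of \<open>h\<close> and its inverse give \<open>m\<close> and
  \<open>d\<close>. For the normalisation, the second factor is reparametrised by the homeomorphism
  \<open>m e\<close> with inverse \<open>d e\<close>: the operations become
  \<open>m x (d e y)\<close> and \<open>m e (d x y)\<close>.\<close>

lemma rectifiable_space_imp_rectified_space:
  assumes "regular_space X" "t1_space X" "rectifiable_space X"
  obtains e mu dl where "rectified_space X e mu dl"
proof -
  obtain e h where e: "e \<in> topspace X"
    and h: "homeomorphic_map (prod_topology X X) (prod_topology X X) h"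
    and he: "\<And>x. x \<in> topspace X \<Longrightarrow> h (x, e) = (x, x)"
    and hx: "\<And>x. x \<in> topspace X \<Longrightarrow> h ` ({x} \<times> topspace X) \<subseteq> {x} \<times> topspace X"
    using assms(3) unfolding rectifiable_space_def by blast
  obtain g where "homeomorphic_maps (prod_topology X X) (prod_topology X X) h g"
    using h homeomorphic_map_maps by blast
  then have ch: "continuous_map (prod_topology X X) (prod_topology X X) h"
    and cg: "continuous_map (prod_topology X X) (prod_topology X X) g"
    and gh: "\<And>x y. x \<in> topspace X \<Longrightarrow> y \<in> topspace X \<Longrightarrow> g (h (x, y)) = (x, y)"
    and hg: "\<And>x y. x \<in> topspace X \<Longrightarrow> y \<in> topspace X \<Longrightarrow> h (g (x, y)) = (x, y)"
    unfolding homeomorphic_maps_def by auto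
  define m where "m x y = snd (h (x, y))" for x y
  define d where "d x y = snd (g (x, y))" for x y
  have hm: "h (x, y) = (x, m x y)" and m_in: "m x y \<in> topspace X"
    if "x \<in> topspace X" "y \<in> topspace X" for x y
    using hx[of x] that unfolding m_def by force+
  have g_in: "g (x, y) \<in> topspace X \<times> topspace X"
    if "x \<in> topspace X" "y \<in> topspace X" for x y
    using cg that unfolding continuous_map_def by auto
  \<comment> \<open>The inverse respects the fibres as well: \<open>h\<close> keeps the first
    coordinate \<open>a\<close> of \<open>g (x, y)\<close>, while
    \<open>h (g (x, y)) = (x, y)\<close>.\<close>
  have gd: "g (x, y) = (x, d x y)" and d_in: "d x y \<in> topspace X"
    if "x \<in> topspace X" "y \<in> topspace X" for x y
  proof -
    obtain a b where ab: "g (x, y) = (a, b)" by fastforce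
    then have "a \<in> topspace X" "b \<in> topspace X"
      using g_in[OF that] by auto
    then have "h (g (x, y)) = (a, m a b)"
      using hm ab by simp
    then show "g (x, y) = (x, d x y)" "d x y \<in> topspace X"
      using hg[OF that] ab \<open>b \<in> topspace X\<close> by (auto simp: d_def)
  qed
  have cm: "continuous_map (prod_topology X X) X (\<lambda>(x, y). m x y)"
    using continuous_map_compose[OF ch continuous_map_snd]
    by (simp add: m_def o_def case_prod_unfold)
  have cd: "continuous_map (prod_topology X X) X (\<lambda>(x, y). d x y)"
    using continuous_map_compose[OF cg continuous_map_snd]
    by (simp add: d_def o_def case_prod_unfold)
  have me: "m x e = x" if "x \<in> topspace X" for x
    using he[OF that] by (simp add: m_def)
  have md: "m x (d x y) = y" and dm: "d x (m x y) = y"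
    if "x \<in> topspace X" "y \<in> topspace X" for x y
    using hg[OF that] gd[OF that] hm[OF that(1) d_in[OF that]]
      gh[OF that] hm[OF that] gd[OF that(1) m_in[OF that]] by auto
  have ds: "d x x = e" if "x \<in> topspace X" for x
    using dm[OF that e] me[OF that] by simp
  have ce: "continuous_map (prod_topology X X) X (\<lambda>p. e)"
    using e by simp
  have cmu: "continuous_map (prod_topology X X) X (\<lambda>(x, y). m x (d e y))"
  proof -
    have "continuous_map (prod_topology X X) (prod_topology X X) (\<lambda>p. (e, snd p))"
      using ce by (simp add: continuous_map_pairedI continuous_map_snd)
    from continuous_map_compose[OF this cd]
    have "continuous_map (prod_topology X X) X (\<lambda>p. d e (snd p))"
      by (simp add: o_def)
    then have "continuous_map (prod_topology X X) (prod_topology X X) (\<lambda>p. (fst p, d e (snd p)))"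
      by (simp add: continuous_map_pairedI continuous_map_fst)
    from continuous_map_compose[OF this cm] show ?thesis
      by (simp add: o_def case_prod_unfold)
  qed
  have cdl: "continuous_map (prod_topology X X) X (\<lambda>(x, y). m e (d x y))"
  proof -
    have "continuous_map (prod_topology X X) (prod_topology X X) (\<lambda>p. (e, (\<lambda>(x, y). d x y) p))"
      using ce cd by (intro continuous_map_pairedI)
    from continuous_map_compose[OF this cm] show ?thesis
      by (simp add: o_def case_prod_unfold)
  qed
  have "rectified_space X e (\<lambda>x y. m x (d e y)) (\<lambda>x y. m e (d x y))"
    by unfold_locales (use assms e cmu cdl in \<open>simp_all add: me md dm ds d_in m_in\<close>)
  then show thesis ..
qed

context rectified_space
begin

text \<open>Symmetry is built in: unlike in a group, \<open>dl y x\<close> need not be a function of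
  \<open>dl x y\<close>.\<close>

definition near :: "'a set \<Rightarrow> 'a \<Rightarrow> 'a \<Rightarrow> bool" where
  "near T x y \<longleftrightarrow> dl x y \<in> T \<and> dl y x \<in> T"

lemma Hausdorff: "Hausdorff_space X"
  by (simp add: reg t1 regular_t1_imp_Hausdorff_space)

lemma mu_in: "x \<in> topspace X \<Longrightarrow> y \<in> topspace X \<Longrightarrow> mu x y \<in> topspace X"
  using funcset_mem[OF continuous_map_funspace[OF cont_mu], of "(x, y)"] by simp

lemma dl_in: "x \<in> topspace X \<Longrightarrow> y \<in> topspace X \<Longrightarrow> dl x y \<in> topspace X"
  using funcset_mem[OF continuous_map_funspace[OF cont_dl], of "(x, y)"] by simp

lemma dl_eq_e: "x \<in> topspace X \<Longrightarrow> y \<in> topspace X \<Longrightarrow> dl x y = e \<Longrightarrow> x = y"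
  by (metis mu_dl mu_e)

lemmas limitin_mu = limitin_continuous_map_pair[OF cont_mu]
lemmas limitin_dl = limitin_continuous_map_pair[OF cont_dl]

lemma
  assumes "f \<in> topspace X"
  shows continuous_map_dl_left: "continuous_map X X (\<lambda>y. dl f y)"
    and continuous_map_dl_right: "continuous_map X X (\<lambda>y. dl y f)"
proof -
  have 1: "continuous_map X (prod_topology X X) (\<lambda>y. (f, y))"
    and 2: "continuous_map X (prod_topology X X) (\<lambda>y. (y, f))"
    using assms by (simp_all add: continuous_map_pairedI)
  show "continuous_map X X (\<lambda>y. dl f y)" "continuous_map X X (\<lambda>y. dl y f)"
    using continuous_map_compose[OF 1 cont_dl] continuous_map_compose[OF 2 cont_dl]
    by (simp_all add: o_def)
qed

lemma closedin_near:
  assumes "closedin X C" "f \<in> topspace X"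
  shows "closedin X {y \<in> topspace X. near C f y}"
proof -
  have "{y \<in> topspace X. near C f y} = {y \<in> topspace X. dl f y \<in> C} \<inter> {y \<in> topspace X. dl y f \<in> C}"
    unfolding near_def by blast
  then show ?thesis
    using assms by (auto intro!: closedin_Int closedin_continuous_map_preimage
        continuous_map_dl_left continuous_map_dl_right)
qed

lemma openin_near:
  assumes "openin X U" "f \<in> topspace X"
  shows "openin X {y \<in> topspace X. near U f y}"
proof -
  have "{y \<in> topspace X. near U f y} = {y \<in> topspace X. dl f y \<in> U} \<inter> {y \<in> topspace X. dl y f \<in> U}"
    unfolding near_def by blast
  then show ?thesis
    using assms by (auto intro!: openin_Int openin_continuous_map_preimage
        continuous_map_dl_left continuous_map_dl_right)
qed

lemma near_nhds_diagonal:
  assumes "openin X U" "e \<in> U" "x \<in> topspace X"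
  obtains V where "openin X V" "x \<in> V" "\<And>p q. p \<in> V \<Longrightarrow> q \<in> V \<Longrightarrow> near U p q"
proof -
  have "dl x x \<in> U"
    using assms by (simp add: dl_self)
  from continuous_map_pair_nhds[OF cont_dl assms(3,3,1) this] obtain V W where
    VW: "openin X V" "x \<in> V" "openin X W" "x \<in> W" "\<And>a b. a \<in> V \<Longrightarrow> b \<in> W \<Longrightarrow> dl a b \<in> U"
    by blast
  show thesis
    by (rule that[of "V \<inter> W"]) (use VW in \<open>auto simp: near_def\<close>)
qed

end

section \<open>Consequences of countability conditions at \<open>e\<close>\<close>

text \<open>The relations are \<open>near (W n)\<close> for a decreasing base \<open>W n\<close> at
  \<open>e\<close>. They are locally small because \<open>z = mu y (dl y z)\<close> and
  \<open>mu\<close> is continuous at \<open>(x, e)\<close>.\<close>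

lemma (in rectified_space) first_countable_imp_paracompact:
  fixes U :: "nat \<Rightarrow> 'a set"
  assumes U: "\<And>n. openin X (U n)" "\<And>n. e \<in> U n"
    and base: "\<And>V. openin X V \<Longrightarrow> e \<in> V \<Longrightarrow> \<exists>n. U n \<subseteq> V"
  shows "paracompact_space X"
proof -
  define W where "W n = \<Inter>(U ` {..n})" for n
  have W: "openin X (W n)" "e \<in> W n" for n
    unfolding W_def using U by (auto intro!: openin_Inter)
  have W_dec: "W n \<subseteq> W m" if "m \<le> n" for m n
    unfolding W_def using that by auto
  have W_base: "\<exists>n. W n \<subseteq> V" if V: "openin X V" "e \<in> V" for V
    using base[OF V] unfolding W_def by blast
  define E where "E n x y \<longleftrightarrow> x \<in> topspace X \<and> y \<in> topspace X \<and> near (W n) x y" for n x y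
  show ?thesis
  proof (rule entourages_imp_paracompact[OF Hausdorff, of E])
    fix n x y assume "E n x y"
    then show "y \<in> topspace X" "E n y x"
      unfolding E_def near_def by auto
  next
    fix n x assume "x \<in> topspace X"
    then show "E n x x"
      unfolding E_def near_def using W by (simp add: dl_self)
  next
    fix m n x y assume "m \<le> n" "E n x y"
    then show "E m x y"
      unfolding E_def near_def using W_dec by blast
  next
    fix n x
    show "openin X {y. E n x y}"
    proof (cases "x \<in> topspace X")
      case True
      then have "{y. E n x y} = {y \<in> topspace X. near (W n) x y}"
        unfolding E_def by blast
      then show ?thesis
        using openin_near[OF W(1) True] by simp
    next
      case False
      then show ?thesis
        by (simp add: E_def)
    qed
  next
    fix n x assume "x \<in> topspace X"
    from near_nhds_diagonal[OF W this] obtain V where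
      "openin X V" "x \<in> V" "\<And>p q. p \<in> V \<Longrightarrow> q \<in> V \<Longrightarrow> near (W n) p q" by blast
    then show "\<exists>V. openin X V \<and> x \<in> V \<and> (\<forall>p\<in>V. \<forall>q\<in>V. E n p q)"
      unfolding E_def using openin_subset by blast
  next
    fix x O' assume O': "openin X O'" "x \<in> O'"
    then have x: "x \<in> topspace X"
      using openin_subset by blast
    then have "mu x e \<in> O'"
      using O' by (simp add: mu_e)
    from continuous_map_pair_nhds[OF cont_mu x e_in O'(1) this] obtain V T where
      V: "openin X V" "x \<in> V" and T: "openin X T" "e \<in> T"
      and VT: "\<And>a b. a \<in> V \<Longrightarrow> b \<in> T \<Longrightarrow> mu a b \<in> O'" by blast
    obtain n where n: "W n \<subseteq> T"
      using W_base[OF T] by blast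
    have "z \<in> O'" if "y \<in> V" "E n y z" for y z
    proof -
      have "mu y (dl y z) \<in> O'"
        using that n unfolding E_def near_def by (intro VT) auto
      then show ?thesis
        using that by (simp add: mu_dl E_def)
    qed
    then show "\<exists>n V. openin X V \<and> x \<in> V \<and> (\<forall>y\<in>V. \<forall>z. E n y z \<longrightarrow> z \<in> O')"
      using V by blast
  qed
qed

text \<open>The covers by open sets whose points are pairwise \<open>near (G n)\<close> separate
  points, since \<open>dl x y\<close> lies in every \<open>G n\<close> only for
  \<open>x = y\<close>.\<close>

lemma (in rectified_space) paracompact_imp_submetrizable:
  fixes G :: "nat \<Rightarrow> 'a set"
  assumes para: "paracompact_space X"
    and G: "\<And>n. openin X (G n)" "\<And>n. e \<in> G n" "(\<Inter>n. G n) \<subseteq> {e}"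
  shows "submetrizable_space X"
proof (rule regular_paracompact_imp_submetrizable[OF reg para])
  let ?\<U> = "\<lambda>n. {U. openin X U \<and> (\<forall>p\<in>U. \<forall>q\<in>U. near (G n) p q)}"
  show "openin X U" if "U \<in> ?\<U> n" for n U
    using that by blast
  show "topspace X \<subseteq> \<Union>(?\<U> n)" for n
  proof
    fix x assume "x \<in> topspace X"
    from near_nhds_diagonal[OF G(1,2) this] obtain V where
      "openin X V" "x \<in> V" "\<And>p q. p \<in> V \<Longrightarrow> q \<in> V \<Longrightarrow> near (G n) p q" by blast
    then show "x \<in> \<Union>(?\<U> n)" by blast
  qed
  fix x y assume xy: "x \<in> topspace X" "y \<in> topspace X"
    and "\<And>n. \<exists>U\<in>?\<U> n. x \<in> U \<and> y \<in> U"
  then have "dl x y \<in> G n" for n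
    unfolding near_def by blast
  then have "dl x y = e"
    using G(3) by blast
  then show "x = y"
    by (rule dl_eq_e[OF xy])
qed

text \<open>By regularity every point of \<open>H\<close> other than \<open>e\<close> lies in a
  network member whose closure misses \<open>e\<close>. The complements of these closures and
  \<open>H\<close> itself are countably many open sets that together exclude all points but
  \<open>e\<close>.\<close>

lemma (in rectified_space) countable_network_imp_G_delta:
  assumes H: "openin X H" "e \<in> H" "has_countable_network X H"
  obtains G :: "nat \<Rightarrow> 'a set"
  where "\<And>n. openin X (G n)" "\<And>n. e \<in> G n" "(\<Inter>n. G n) \<subseteq> {e}"
proof -
  obtain \<W> where \<W>: "countable \<W>"
    "\<And>x U. x \<in> H \<Longrightarrow> openin X U \<Longrightarrow> x \<in> U \<Longrightarrow> \<exists>W\<in>\<W>. x \<in> W \<and> W \<subseteq> U"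
    using H(3) unfolding has_countable_network_def by meson
  define \<G> where "\<G> = insert H ((\<lambda>W. topspace X - X closure_of W) ` {W \<in> \<W>. e \<notin> X closure_of W})"
  have \<G>: "countable \<G>" "\<G> \<noteq> {}"
    unfolding \<G>_def using \<W>(1) by auto
  have in_\<G>: "from_nat_into \<G> n \<in> \<G>" for n
    using \<G>(2) by (rule from_nat_into)
  have op: "openin X T \<and> e \<in> T" if "T \<in> \<G>" for T
    using that H e_in unfolding \<G>_def by auto
  show thesis
  proof (rule that[of "from_nat_into \<G>"])
    show "(\<Inter>n. from_nat_into \<G> n) \<subseteq> {e}"
    proof
      fix y assume "y \<in> (\<Inter>n. from_nat_into \<G> n)"
      then have y: "y \<in> T" if "T \<in> \<G>" for T
        using from_nat_into_surj[OF \<G>(1) that] by blast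
      then have "y \<in> H"
        unfolding \<G>_def by blast
      then have y_in: "y \<in> topspace X"
        using openin_subset[OF H(1)] by blast
      show "y \<in> {e}"
      proof (rule ccontr)
        assume "y \<notin> {e}"
        moreover have "closedin X {e}"
          using t1 e_in by (simp add: t1_space_closedin_singleton)
        ultimately have "openin X (topspace X - {e})" "y \<in> topspace X - {e}"
          using y_in by auto
        from regular_space_shrink[OF reg this] obtain V where
          V: "openin X V" "y \<in> V" "X closure_of V \<subseteq> topspace X - {e}" by blast
        obtain W where W: "W \<in> \<W>" "y \<in> W" "W \<subseteq> V"
          using \<W>(2)[OF \<open>y \<in> H\<close> V(1,2)] by blast
        have "X closure_of W \<subseteq> X closure_of V"
          using W(3) by (rule closure_of_mono)
        then have "topspace X - X closure_of W \<in> \<G>"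
          unfolding \<G>_def using W(1) V(3) by blast
        then have "y \<notin> X closure_of W"
          using y by blast
        moreover have "W \<subseteq> X closure_of W"
          using W(3) openin_subset[OF V(1)] by (intro closure_of_subset) blast
        ultimately show False
          using W(2) by blast
      qed
    qed
  qed (use op in_\<G> in blast)+
qed

section \<open>Countable cs*-character\<close>

text \<open>The sets \<open>N i\<close> enumerate a cs*-network at \<open>e\<close>; passing to closures, they may be assumed
  to be closed.\<close>

locale cs_rectified_space = rectified_space +
  fixes N :: "nat \<Rightarrow> 'a set"
  assumes sequential: "sequential_space X"
    and N_closed: "closedin X (N i)"
    and N_net: "\<lbrakk>openin X U; e \<in> U; range s \<subseteq> topspace X; limitin X s e sequentially\<rbrakk>
      \<Longrightarrow> \<exists>i. N i \<subseteq> U \<and> infinite {n. s n \<in> N i}"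
begin

text \<open>Finite stages of the network sets inside \<open>V\<close>, closed and increasing in
  \<open>n\<close>. The point \<open>e\<close> is added because the \<open>N i\<close> are not
  assumed to contain it.\<close>

definition B :: "'a set \<Rightarrow> nat \<Rightarrow> 'a set" where
  "B V n = {e} \<union> \<Union>(N ` {i. i \<le> n \<and> N i \<subseteq> V})"

text \<open>A countable family that contains every \<open>B V n\<close>, although there may be
  uncountably many \<open>V\<close>.\<close>

definition finite_unions :: "'a set set" where
  "finite_unions = (\<lambda>I. {e} \<union> \<Union>(N ` I)) ` {I. finite I}"

text \<open>Barriers are the sequential neighbourhoods of \<open>e\<close>: by passing to
  subsequences, meeting every sequence amounts to containing almost all terms of each.\<close>

definition barrier :: "'a set \<Rightarrow> bool" where
  "barrier T \<longleftrightarrow>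
     (\<forall>s. range s \<subseteq> topspace X \<and> limitin X s e sequentially \<longrightarrow> (\<exists>n::nat. s n \<in> T))"

text \<open>Total boundedness with the smaller set \<open>B V n\<close> in place of
  \<open>V\<close>. This is the stronger condition, and only countably many sets
  \<open>B V n\<close> occur in it.\<close>

definition precompact :: "'a set \<Rightarrow> bool" where
  "precompact P \<longleftrightarrow> (\<forall>V. openin X V \<and> e \<in> V \<longrightarrow>
     (\<exists>n F. finite F \<and> F \<subseteq> topspace X \<and> P \<subseteq> (\<Union>f\<in>F. {y. near (B V n) f y})))"

lemma countable_finite_unions: "countable finite_unions"
  unfolding finite_unions_def
  by (intro countable_image countable_Collect_finite)

lemma B_in_finite_unions: "B V n \<in> finite_unions"
  unfolding B_def finite_unions_def by auto

lemma closedin_B: "closedin X (B V n)"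
proof -
  have "closedin X {e}"
    using t1 e_in by (simp add: t1_space_closedin_singleton)
  moreover have "closedin X (\<Union>(N ` {i. i \<le> n \<and> N i \<subseteq> V}))"
    by (rule closedin_Union) (auto simp: N_closed)
  ultimately show ?thesis
    unfolding B_def by (rule closedin_Un)
qed

lemma B_mono: "m \<le> n \<Longrightarrow> B V m \<subseteq> B V n"
  unfolding B_def by fastforce

lemma B_subset: "e \<in> V \<Longrightarrow> B V n \<subseteq> V"
  unfolding B_def by auto

lemma e_in_B: "e \<in> B V n"
  unfolding B_def by auto

text \<open>A network set inside \<open>V\<close> contains arbitrarily late terms, and such a term
  \<open>s n\<close> with \<open>n \<ge> i\<close> lies in stage \<open>n\<close>. Using one
  \<open>n\<close> for term and stage is what diagonal choices that avoid stage \<open>n\<close> at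
  step \<open>n\<close> run into.\<close>

lemma B_meets:
  assumes "openin X V" "e \<in> V" "range s \<subseteq> topspace X" "limitin X s e sequentially"
  shows "\<exists>n. s n \<in> B V n"
proof -
  obtain i where i: "N i \<subseteq> V" "infinite {n. s n \<in> N i}"
    using N_net[OF assms] by blast
  then obtain n where "n \<ge> i" "s n \<in> N i"
    by (auto simp: infinite_nat_iff_unbounded_le)
  then have "s n \<in> B V n"
    using i unfolding B_def by auto
  then show ?thesis ..
qed

text \<open>A Cauchy property with respect to a single stage. Otherwise \<open>J m\<close> and
  \<open>J' m\<close> violate it at every stage \<open>m\<close>, while the resulting quotients tend
  to \<open>dl z z = e\<close>, against \<open>B_meets\<close>.\<close>

lemma B_pairs:
  assumes V: "openin X V" "e \<in> V" and a: "range a \<subseteq> topspace X" "limitin X a z sequentially"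
  obtains m where "\<And>j j'. j \<ge> m \<Longrightarrow> j' \<ge> m \<Longrightarrow> dl (a j) (a j') \<in> B V m"
proof (rule ccontr)
  assume "\<not> thesis"
  then have "\<forall>m. \<exists>j j'. j \<ge> m \<and> j' \<ge> m \<and> dl (a j) (a j') \<notin> B V m"
    using that by blast
  then obtain J J' where J: "\<And>m. J m \<ge> m" "\<And>m. J' m \<ge> m"
    and out: "\<And>m. dl (a (J m)) (a (J' m)) \<notin> B V m"
    by metis
  have "filterlim J at_top sequentially" "filterlim J' at_top sequentially"
    using J by (auto intro: filterlim_at_top_mono[OF filterlim_ident] always_eventually)
  then have "limitin X (\<lambda>m. dl (a (J m)) (a (J' m))) (dl z z) sequentially"
    by (intro limitin_dl limitin_compose_filterlim[OF a(2)])
  moreover have "dl z z = e"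
    using limitin_topspace[OF a(2)] by (rule dl_self)
  ultimately have lim: "limitin X (\<lambda>m. dl (a (J m)) (a (J' m))) e sequentially"
    by (rule back_subst[of "\<lambda>l. limitin X (\<lambda>m. dl (a (J m)) (a (J' m))) l sequentially"])
  have "range (\<lambda>m. dl (a (J m)) (a (J' m))) \<subseteq> topspace X"
    using a(1) dl_in by (auto intro!: dl_in)
  from B_meets[OF V this lim] obtain n where "dl (a (J n)) (a (J' n)) \<in> B V n" ..
  then show False
    using out by blast
qed

lemma eventually_notin_closedin:
  assumes "closedin X C" "limitin X s x F" "x \<notin> C" "\<And>n. s n \<in> topspace X"
  shows "\<forall>\<^sub>F n in F. s n \<notin> C"
proof -
  have "openin X (topspace X - C)" "x \<in> topspace X - C"
    using assms limitin_topspace by auto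
  then have "\<forall>\<^sub>F n in F. s n \<in> topspace X - C"
    using assms(2) unfolding limitin_def by blast
  then show ?thesis
    by (rule eventually_mono) auto
qed

lemma eventually_not_near:
  assumes "limitin X s d F" "\<And>n. s n \<in> topspace X" "f \<in> topspace X" "\<not> near (B V m) f d"
  shows "\<forall>\<^sub>F n in F. \<not> near (B V m) f (s n)"
proof -
  from eventually_notin_closedin[OF closedin_near[OF closedin_B assms(3)] assms(1) _ assms(2)]
  show ?thesis
    using assms by (auto elim: eventually_mono)
qed

lemma barrier_eventually:
  assumes "barrier T" "range s \<subseteq> topspace X" "limitin X s e sequentially"
  shows "\<forall>\<^sub>F n in sequentially. s n \<in> T"
proof (rule ccontr)
  assume "\<not> ?thesis"
  then have inf: "infinite {n. s n \<notin> T}"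
    using eventually_cofinite[of "\<lambda>n. s n \<in> T"] by (simp add: cofinite_eq_sequentially)
  obtain r :: "nat \<Rightarrow> nat" where r: "strict_mono r" "\<And>n. s (r n) \<notin> T"
    using infinite_enumerate[OF inf] by auto
  have "limitin X (s \<circ> r) e sequentially" "range (s \<circ> r) \<subseteq> topspace X"
    using limitin_subsequence r(1) assms by auto
  then have "\<exists>n. (s \<circ> r) n \<in> T"
    using assms(1) unfolding barrier_def by blast
  then show False
    using r(2) by simp
qed

section \<open>A neighbourhood without barriers: fans and precompact sets\<close>

text \<open>Row \<open>k\<close> is a sequence avoiding \<open>B V k\<close>, cut off at its
  beginning. As \<open>i\<close> grows, \<open>dl (s k i) (s k' i')\<close> tends to
  \<open>dl e (s k' i') = s k' i'\<close>, which is outside the closed set \<open>B V k'\<close>;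
  late \<open>i\<close> thus keep the quotient outside. A convergent transversal would then
  contradict \<open>B_pairs\<close>.\<close>

lemma fan_without_convergent_transversals:
  assumes V: "openin X V" "e \<in> V" and no: "\<And>n. \<not> barrier (B V n)"
  obtains S :: "nat \<Rightarrow> nat \<Rightarrow> 'a"
  where "\<And>k i. S k i \<in> topspace X" "\<And>k. limitin X (S k) e sequentially"
    "\<And>k i z. strict_mono k \<Longrightarrow> \<not> limitin X (\<lambda>j. S (k j) (i j)) z sequentially"
proof -
  have "\<forall>k. \<exists>s. range s \<subseteq> topspace X \<and> limitin X s e sequentially \<and> (\<forall>i. s i \<notin> B V k)"
    using no unfolding barrier_def by blast
  then obtain s where s: "\<And>k. range (s k) \<subseteq> topspace X"
      "\<And>k. limitin X (s k) e sequentially" "\<And>k i. s k i \<notin> B V k"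
    by metis
  have s_in: "s k i \<in> topspace X" for k i
    using s(1) by blast
  have "\<forall>k' i' k. \<exists>\<theta>. \<forall>i\<ge>\<theta>. dl (s k i) (s k' i') \<notin> B V k'"
  proof (intro allI)
    fix k' i' k
    have "limitin X (\<lambda>i. dl (s k i) (s k' i')) (dl e (s k' i')) sequentially"
      by (intro limitin_dl s) (simp add: s_in)
    then have "limitin X (\<lambda>i. dl (s k i) (s k' i')) (s k' i') sequentially"
      by (simp add: dl_e s_in)
    from eventually_notin_closedin[OF closedin_B this s(3)]
    show "\<exists>\<theta>. \<forall>i\<ge>\<theta>. dl (s k i) (s k' i') \<notin> B V k'"
      using s_in dl_in by (auto simp: eventually_sequentially)
  qed
  then obtain \<theta> where \<theta>: "\<And>k' i' k i. i \<ge> \<theta> k' i' k \<Longrightarrow> dl (s k i) (s k' i') \<notin> B V k'"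
    unfolding choice_iff by blast
  \<comment> \<open>The sum is a common bound for the finitely many thresholds with
    \<open>k' \<le> k\<close> and \<open>i' \<le> k\<close>.\<close>
  define g where "g k = (\<Sum>k'\<le>k. \<Sum>i'\<le>k. \<theta> k' i' k)" for k
  have g: "\<theta> k' i' k \<le> g k" if "k' \<le> k" "i' \<le> k" for k' i' k
  proof -
    have "\<theta> k' i' k \<le> (\<Sum>i'\<le>k. \<theta> k' i' k)"
      using that by (intro member_le_sum) auto
    also have "\<dots> \<le> g k"
      unfolding g_def using that by (intro member_le_sum[of k' _ "\<lambda>k'. \<Sum>i'\<le>k. \<theta> k' i' k"]) auto
    finally show ?thesis .
  qed
  define S where "S k i = s k (i + g k)" for k i
  have "\<not> limitin X (\<lambda>j. S (k j) (i j)) z sequentially" if k: "strict_mono k" for k i z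
  proof
    assume "limitin X (\<lambda>j. S (k j) (i j)) z sequentially"
    then obtain m where m: "\<And>j j'. j \<ge> m \<Longrightarrow> j' \<ge> m \<Longrightarrow>
        dl (S (k j) (i j)) (S (k j') (i j')) \<in> B V m"
      using B_pairs[OF V, of "\<lambda>j. S (k j) (i j)" z] s_in unfolding S_def by blast
    define k' where "k' = k m"
    define i' where "i' = i m + g k'"
    \<comment> \<open>\<open>j\<close> is so large that the cut of row \<open>k j\<close> takes
      account of the \<open>m\<close>-th term, whose position in the uncut row \<open>k'\<close> is
      \<open>i'\<close>.\<close>
    define j where "j = Max {m, k', i'}"
    have j: "j \<ge> m" "k j \<ge> k'" "k j \<ge> i'"
      using strict_mono_imp_increasing[OF k, of j] unfolding j_def by auto
    have "dl (S (k j) (i j)) (S (k m) (i m)) \<notin> B V k'"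
      unfolding S_def k'_def[symmetric] i'_def[symmetric]
      using \<theta>[of k' i' "k j"] g[OF j(2,3)] by auto
    moreover have "B V m \<subseteq> B V k'"
      unfolding k'_def using B_mono strict_mono_imp_increasing[OF k] by blast
    ultimately show False
      using m[of j m] j(1) by auto
  qed
  moreover have "limitin X (S k) e sequentially" for k
    unfolding S_def by (rule limitin_sequentially_offset[OF s(2)])
  moreover have "S k i \<in> topspace X" for k i
    unfolding S_def by (rule s_in)
  ultimately show thesis
    by (intro that[of S])
qed


text \<open>Otherwise the fan \<open>S\<close> can be spread over the sets \<open>A k\<close>: the points \<open>mu d (S k n)\<close> with
  \<open>d \<in> A k\<close> can be chosen so that no sequence of them converges to a new point, while \<open>e\<close> lies in
  their closure. This contradicts sequentiality.\<close>

lemma fan_imp_precompact: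
  fixes S :: "nat \<Rightarrow> nat \<Rightarrow> 'a" and A :: "nat \<Rightarrow> 'a set"
  assumes S_in: "\<And>k i. S k i \<in> topspace X" and S_lim: "\<And>k. limitin X (S k) e sequentially"
    and S_div: "\<And>k i z. strict_mono k \<Longrightarrow> \<not> limitin X (\<lambda>j. S (k j) (i j)) z sequentially"
    and A_sub: "\<And>k. A k \<subseteq> topspace X" and A_dec: "decseq A"
    and A_base: "\<And>U. openin X U \<Longrightarrow> e \<in> U \<Longrightarrow> \<exists>k. A k \<subseteq> U"
  shows "\<exists>k. precompact (A k)"
proof (rule ccontr)
  assume "\<not> ?thesis"
  then have "\<forall>k. \<exists>V. openin X V \<and> e \<in> V \<and>
      (\<forall>n F. F \<subseteq> topspace X \<longrightarrow> finite F \<longrightarrow> \<not> A k \<subseteq> (\<Union>f\<in>F. {y. near (B V n) f y}))"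
    unfolding precompact_def by simp
  from choice[OF this] obtain V where "\<forall>k. openin X (V k) \<and> e \<in> V k \<and>
      (\<forall>n F. F \<subseteq> topspace X \<longrightarrow> finite F \<longrightarrow> \<not> A k \<subseteq> (\<Union>f\<in>F. {y. near (B (V k) n) f y}))" ..
  then have V: "\<And>k. openin X (V k)" "\<And>k. e \<in> V k"
    and nc: "\<And>k n F. finite F \<Longrightarrow> F \<subseteq> topspace X \<Longrightarrow>
      \<not> A k \<subseteq> (\<Union>f\<in>F. {y. near (B (V k) n) f y})"
    by simp_all
  define pt where "pt k p = mu (fst p) (S k (snd p))" for k and p :: "'a \<times> nat"
  have pt_in: "pt k p \<in> topspace X" if "fst p \<in> A k" for k p
    using that A_sub S_in mu_in unfolding pt_def by blast
  \<comment> \<open>The \<open>i\<close>-th point of a row is kept away from \<open>e\<close> and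
    its predecessors at stage \<open>i\<close>, so that any fixed stage is eventually passed;
    \<open>snd (p i) \<ge> i\<close> drives the fan coordinate to infinity.\<close>
  have "\<forall>k. \<exists>p. \<forall>i. fst (p i) \<in> A k \<and> snd (p i) \<ge> i \<and> \<not> near (B (V k) i) e (pt k (p i)) \<and>
      (\<forall>i'<i. \<not> near (B (V k) i) (pt k (p i')) (pt k (p i)))"
  proof
    fix k
    let ?P = "\<lambda>f i q. fst q \<in> A k \<and> snd q \<ge> i \<and> \<not> near (B (V k) i) e (pt k q) \<and>
      (\<forall>i'<i. \<not> near (B (V k) i) (pt k (f i')) (pt k q))"
    show "\<exists>p. \<forall>i. ?P p i (p i)"
    proof (rule dependent_wf_choice[of less_than])
      fix i and p :: "nat \<Rightarrow> 'a \<times> nat"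
      assume IH: "\<And>y. (y, i) \<in> less_than \<Longrightarrow> ?P p y (p y)"
      \<comment> \<open>Finitely many centres never cover \<open>A k\<close>, which gives
        \<open>d\<close> far from \<open>F\<close>. Since \<open>mu d (S k n)\<close> tends to
        \<open>d\<close> and the sets of near points are closed, late \<open>n\<close> keep the new
        point far from \<open>F\<close>.\<close>
      define F where "F = insert e ((\<lambda>i'. pt k (p i')) ` {..<i})"
      have F: "finite F" "F \<subseteq> topspace X"
        using IH e_in unfolding F_def by (auto intro!: pt_in)
      then obtain d where d: "d \<in> A k" and far: "\<And>f. f \<in> F \<Longrightarrow> \<not> near (B (V k) i) f d"
        using nc[of F k i] by blast
      have d_in: "d \<in> topspace X"
        using d A_sub by blast
      then have "limitin X (\<lambda>n. mu d (S k n)) (mu d e) sequentially"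
        by (intro limitin_mu S_lim) simp
      then have "limitin X (\<lambda>n. mu d (S k n)) d sequentially"
        by (simp add: mu_e d_in)
      then have "\<forall>\<^sub>F n in sequentially. \<forall>f\<in>F. \<not> near (B (V k) i) f (mu d (S k n))"
        using F far d_in S_in mu_in by (intro eventually_ball_finite ballI eventually_not_near) auto
      then have "\<forall>\<^sub>F n in sequentially. n \<ge> i \<and> (\<forall>f\<in>F. \<not> near (B (V k) i) f (mu d (S k n)))"
        using eventually_ge_at_top eventually_conj by blast
      then obtain n where "n \<ge> i" "\<forall>f\<in>F. \<not> near (B (V k) i) f (mu d (S k n))"
        by (metis (mono_tags, lifting) eventually_happens trivial_limit_sequentially)
      then have "?P p i (d, n)"
        using d unfolding F_def pt_def by auto
      then show "\<exists>q. ?P p i q" ..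
    qed auto
  qed
  from choice[OF this] obtain p where "\<forall>k i. fst (p k i) \<in> A k \<and> snd (p k i) \<ge> i \<and>
      \<not> near (B (V k) i) e (pt k (p k i)) \<and>
      (\<forall>i'<i. \<not> near (B (V k) i) (pt k (p k i')) (pt k (p k i)))" ..
  then have p_A: "\<And>k i. fst (p k i) \<in> A k" and p_ge: "\<And>k i. snd (p k i) \<ge> i"
    and p_e: "\<And>k i. \<not> near (B (V k) i) e (pt k (p k i))"
    and p_far: "\<And>k i i'. i' < i \<Longrightarrow> \<not> near (B (V k) i) (pt k (p k i')) (pt k (p k i))"
    by simp_all
  define a where "a k i = pt k (p k i)" for k i
  have a_in: "a k i \<in> topspace X" for k i
    using pt_in p_A unfolding a_def by blast
  define A' where "A' = range (\<lambda>p. a (fst p) (snd p))"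
  have A'_mem: "a k i \<in> A'" for k i
    unfolding A'_def by (rule range_eqI[of _ _ "(k, i)"]) simp
  have "a k i \<noteq> e" for k i
    using p_e[of k i] e_in e_in_B by (auto simp: a_def near_def dl_self)
  then have "e \<notin> A'"
    unfolding A'_def by auto
  \<comment> \<open>The point \<open>e\<close> lies in the closure: for a suitable \<open>k\<close>,
    the set \<open>A k\<close> and a tail of \<open>S k\<close> are so close to \<open>e\<close>
    that their products lie in a given neighbourhood of \<open>e\<close>.\<close>
  have "\<not> closedin X A'"
  proof
    assume "closedin X A'"
    then have "openin X (topspace X - A')" "mu e e \<in> topspace X - A'"
      using \<open>e \<notin> A'\<close> e_in by (auto simp: mu_e)
    from continuous_map_pair_nhds[OF cont_mu e_in e_in this] obtain U W
      where U: "openin X U" "e \<in> U" and W: "openin X W" "e \<in> W"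
        and UW: "\<And>x y. x \<in> U \<Longrightarrow> y \<in> W \<Longrightarrow> mu x y \<in> topspace X - A'"
      by blast
    obtain k where k: "A k \<subseteq> U"
      using A_base U by blast
    obtain i where "\<And>n. n \<ge> i \<Longrightarrow> S k n \<in> W"
      using S_lim[of k] W unfolding limitin_sequentially by blast
    then have "S k (snd (p k i)) \<in> W" "fst (p k i) \<in> U"
      using k p_A p_ge by blast+
    then have "a k i \<in> topspace X - A'"
      unfolding a_def pt_def by (intro UW)
    then show False
      using A'_mem by blast
  qed
  moreover have "A' \<subseteq> topspace X"
    using a_in by (auto simp: A'_def)
  ultimately obtain t z where t: "range t \<subseteq> A'" "z \<notin> A'" "limitin X t z sequentially"
    using sequential unfolding sequential_space_def by metis
  from t(1) have "\<forall>j. \<exists>k i. t j = a k i"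
    unfolding A'_def by fastforce
  then obtain kk ii where tj: "\<And>j. t j = a (kk j) (ii j)"
    unfolding choice_iff by blast
  \<comment> \<open>After passing to a subsequence, \<open>t\<close> repeats one point, runs through
    a single row, or runs through increasing rows.\<close>
  show False
  proof (rule nat_seq_constant_or_strict_mono[of kk])
    fix r :: "nat \<Rightarrow> nat" and c assume r: "strict_mono r" "\<And>j. kk (r j) = c"
    show False
    proof (rule nat_seq_constant_or_strict_mono[of "ii \<circ> r"])
      fix r' :: "nat \<Rightarrow> nat" and c' assume r': "strict_mono r'" "\<And>j. (ii \<circ> r) (r' j) = c'"
      have "limitin X (t \<circ> (r \<circ> r')) z sequentially"
        using r(1) r'(1) t(3) by (intro limitin_subsequence strict_mono_o)
      moreover have "t \<circ> (r \<circ> r') = (\<lambda>j. a c c')"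
        using r(2) r'(2) tj by auto
      moreover have "limitin X (\<lambda>j. a c c') (a c c') sequentially"
        by (simp add: a_in)
      ultimately have "z = a c c'"
        using limitin_Hausdorff_unique[OF _ _ trivial_limit_sequentially Hausdorff] by metis
      then show False
        using t(2) A'_mem by blast
    next
      fix r' :: "nat \<Rightarrow> nat" assume r': "strict_mono r'" "strict_mono (ii \<circ> r \<circ> r')"
      define u where "u j = a c (ii (r (r' j)))" for j
      have "limitin X (t \<circ> (r \<circ> r')) z sequentially"
        using r(1) r'(1) t(3) by (intro limitin_subsequence strict_mono_o)
      moreover have "t \<circ> (r \<circ> r') = u"
        using r(2) tj by (auto simp: u_def)
      ultimately obtain m where m: "\<And>j j'. j \<ge> m \<Longrightarrow> j' \<ge> m \<Longrightarrow> dl (u j) (u j') \<in> B (V c) m"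
        using B_pairs[OF V(1,2)[of c], of u z] a_in by (auto simp: u_def)
      define i where "i j = ii (r (r' j))" for j
      have i: "strict_mono i"
        using r'(2) by (simp add: i_def[abs_def] o_def)
      \<comment> \<open>Convergence within row \<open>c\<close> makes late points near at the fixed
        stage \<open>m\<close>; \<open>p_far\<close> excludes this for the pair \<open>m\<close>,
        \<open>Suc m\<close> at the larger stage \<open>i (Suc m)\<close>.\<close>
      have "near (B (V c) m) (u m) (u (Suc m))"
        using m unfolding near_def by auto
      moreover have "B (V c) m \<subseteq> B (V c) (i (Suc m))"
        using strict_mono_imp_increasing[OF i, of "Suc m"] by (intro B_mono) auto
      ultimately have "near (B (V c) (i (Suc m))) (a c (i m)) (a c (i (Suc m)))"
        unfolding near_def u_def i_def by blast
      moreover have "i m < i (Suc m)"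
        using i by (simp add: strict_mono_Suc_iff)
      ultimately show False
        using p_far unfolding a_def by blast
    qed
  next
    fix r :: "nat \<Rightarrow> nat" assume r: "strict_mono r" "strict_mono (kk \<circ> r)"
    \<comment> \<open>In increasing rows the factors \<open>d j\<close> come from shrinking sets
      \<open>A k\<close> and tend to \<open>e\<close>. Dividing by them leaves a convergent
      transversal of \<open>S\<close>, which \<open>S_div\<close> excludes.\<close>
    define d where "d j = fst (p (kk (r j)) (ii (r j)))" for j
    have "limitin X d e sequentially"
      unfolding limitin_sequentially
    proof (intro conjI allI impI e_in)
      fix U assume "openin X U \<and> e \<in> U"
      then obtain k where k: "A k \<subseteq> U"
        using A_base by blast
      have "d n \<in> U" if "n \<ge> k" for n
      proof -
        have "kk (r n) \<ge> k"
          using strict_mono_imp_increasing[OF r(2), of n] that by simp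
        then have "A (kk (r n)) \<subseteq> A k"
          using A_dec by (simp add: decseqD)
        then show ?thesis
          using k p_A unfolding d_def by blast
      qed
      then show "\<exists>k. \<forall>n\<ge>k. d n \<in> U"
        by blast
    qed
    moreover have "limitin X (\<lambda>j. t (r j)) z sequentially"
      using limitin_subsequence[OF r(1) t(3)] by (simp add: o_def)
    ultimately have "limitin X (\<lambda>j. dl (d j) (t (r j))) (dl e z) sequentially"
      by (rule limitin_dl)
    moreover have "dl (d j) (t (r j)) = S (kk (r j)) (snd (p (kk (r j)) (ii (r j))))" for j
      using p_A A_sub S_in unfolding tj a_def pt_def d_def by (intro dl_mu) auto
    ultimately show False
      using S_div[OF r(2), of "\<lambda>j. snd (p (kk (r j)) (ii (r j)))"] by (simp add: o_def)
  qed
qed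


lemma finite_unions_subset: "F \<in> finite_unions \<Longrightarrow> F \<subseteq> topspace X"
  using closedin_subset[OF N_closed] e_in unfolding finite_unions_def by auto

text \<open>Finite intersections of members of \<open>finite_unions\<close> form a countable family.
  For a given sequence, the members containing almost all its terms include one inside each
  neighbourhood of \<open>e\<close>; so \<open>fan_imp_precompact\<close> makes one of their
  successive intersections precompact, and the sequence meets it.\<close>

lemma countable_precompact_family:
  assumes V: "openin X V" "e \<in> V" and no: "\<And>n. \<not> barrier (B V n)"
  obtains \<P> where "countable \<P>" "\<And>P. P \<in> \<P> \<Longrightarrow> precompact P" "barrier (\<Union>\<P>)" "\<Union>\<P> \<subseteq> topspace X"
proof (rule fan_without_convergent_transversals[OF assms])
  fix S :: "nat \<Rightarrow> nat \<Rightarrow> 'a"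
  assume S: "\<And>k i. S k i \<in> topspace X" "\<And>k. limitin X (S k) e sequentially"
    "\<And>k i z. strict_mono k \<Longrightarrow> \<not> limitin X (\<lambda>j. S (k j) (i j)) z sequentially"
  define \<G> where "\<G> = Inter ` {\<A>. finite \<A> \<and> \<A> \<subseteq> finite_unions}"
  define \<P> where "\<P> = {P \<in> \<G>. precompact P \<and> P \<subseteq> topspace X}"
  have "countable \<P>"
    using countable_Collect_finite_subset[OF countable_finite_unions]
    unfolding \<P>_def \<G>_def by (auto intro: countable_subset)
  moreover have "barrier (\<Union>\<P>)"
    unfolding barrier_def
  proof (intro allI impI)
    fix s :: "nat \<Rightarrow> 'a" assume "range s \<subseteq> topspace X \<and> limitin X s e sequentially"
    then have s: "range s \<subseteq> topspace X" "limitin X s e sequentially" by auto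
    define \<F> where "\<F> = {F \<in> finite_unions. \<forall>\<^sub>F n in sequentially. s n \<in> F}"
    have \<F>_base: "\<exists>F\<in>\<F>. F \<subseteq> U" if U: "openin X U" "e \<in> U" for U
    proof -
      \<comment> \<open>Otherwise terms \<open>s (i n)\<close> outside \<open>B U n\<close> with
        \<open>i n \<ge> n\<close> form a sequence that contradicts \<open>B_meets\<close>.\<close>
      have "\<exists>n. \<forall>i\<ge>n. s i \<in> B U n"
      proof (rule ccontr)
        assume "\<not> ?thesis"
        then obtain i where i: "\<And>n. i n \<ge> n" "\<And>n. s (i n) \<notin> B U n"
          by metis
        have "filterlim i at_top sequentially"
          using i by (auto intro: filterlim_at_top_mono[OF filterlim_ident] always_eventually)
        from limitin_compose_filterlim[OF s(2) this] show False
          using B_meets[OF U, of "\<lambda>n. s (i n)"] s(1) i(2) by auto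
      qed
      then obtain n where "\<forall>i\<ge>n. s i \<in> B U n" ..
      then have "B U n \<in> \<F>"
        unfolding \<F>_def eventually_sequentially using B_in_finite_unions by blast
      then show ?thesis
        using B_subset U(2) by blast
    qed
    have \<F>_ne: "\<F> \<noteq> {}"
      using \<F>_base[OF openin_topspace e_in] by blast
    have "\<F> \<subseteq> finite_unions"
      unfolding \<F>_def by blast
    then have \<F>_count: "countable \<F>"
      using countable_finite_unions countable_subset by blast
    define A where "A k = (\<Inter>i\<le>k. from_nat_into \<F> i)" for k
    have A_ev: "\<forall>\<^sub>F n in sequentially. s n \<in> A k" for k
      unfolding A_def INT_iff using from_nat_into[OF \<F>_ne]
      by (intro eventually_ball_finite) (auto simp: \<F>_def)
    have A_sub: "A k \<subseteq> topspace X" for k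
      using from_nat_into[OF \<F>_ne, of 0] finite_unions_subset
      unfolding A_def \<F>_def by fastforce
    have "\<exists>k. precompact (A k)"
    proof (rule fan_imp_precompact[OF S A_sub])
      show "decseq A"
        unfolding A_def decseq_def by fastforce
    next
      fix U assume "openin X U" "e \<in> U"
      then obtain F where "F \<in> \<F>" "F \<subseteq> U"
        using \<F>_base by blast
      moreover then obtain k where "from_nat_into \<F> k = F"
        using from_nat_into_surj[OF \<F>_count] by blast
      ultimately show "\<exists>k. A k \<subseteq> U"
        unfolding A_def by blast
    qed
    then obtain k where "precompact (A k)" ..
    moreover have "A k \<in> \<G>"
      unfolding \<G>_def
    proof (rule image_eqI)
      show "A k = \<Inter>(from_nat_into \<F> ` {..k})"
        by (simp add: A_def)
      show "from_nat_into \<F> ` {..k} \<in> {\<A>. finite \<A> \<and> \<A> \<subseteq> finite_unions}"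
        using from_nat_into[OF \<F>_ne] \<open>\<F> \<subseteq> finite_unions\<close> by blast
    qed
    ultimately have "A k \<in> \<P>"
      unfolding \<P>_def using A_sub by blast
    moreover obtain n where "s n \<in> A k"
      using A_ev[of k] by (metis eventually_happens trivial_limit_sequentially)
    ultimately show "\<exists>n. s n \<in> \<Union>\<P>"
      by blast
  qed
  ultimately show thesis
    using that unfolding \<P>_def by blast
qed


section \<open>Barriers in every neighbourhood: first countability\<close>

text \<open>A diagonal argument shows that sequential closures are closed. Removing from the space
  the sequential closure of the complement of a barrier therefore leaves an open neighbourhood of
  \<open>e\<close> inside the barrier, and there are countably many barriers to consider.\<close>

lemma barriers_imp_first_countable:
  assumes bar: "\<And>V. openin X V \<Longrightarrow> e \<in> V \<Longrightarrow> \<exists>n. barrier (B V n)"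
  obtains U :: "nat \<Rightarrow> 'a set" where "\<And>n. openin X (U n)" "\<And>n. e \<in> U n"
    "\<And>V. openin X V \<Longrightarrow> e \<in> V \<Longrightarrow> \<exists>n. U n \<subseteq> V"
proof -
  define \<T> where "\<T> = {T \<in> finite_unions. barrier T}"
  have T_base: "\<exists>T\<in>\<T>. T \<subseteq> V" if V: "openin X V" "e \<in> V" for V
    using bar[OF V] B_subset[OF V(2)] B_in_finite_unions unfolding \<T>_def by blast
  have "\<T> \<subseteq> finite_unions"
    unfolding \<T>_def by blast
  then have count: "countable \<T>"
    using countable_finite_unions countable_subset by blast
  have ne: "\<T> \<noteq> {}"
    using T_base[OF openin_topspace e_in] by blast
  define T where "T = from_nat_into \<T>"
  have T_bar: "barrier (T n)" for n
    using from_nat_into[OF ne, of n] unfolding T_def \<T>_def by blast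
  have T_base': "\<exists>n. T n \<subseteq> V" if V: "openin X V" "e \<in> V" for V
    using T_base[OF V] from_nat_into_surj[OF count] unfolding T_def by metis
  define seqcl where "seqcl A = {x. \<exists>s::nat \<Rightarrow> 'a. range s \<subseteq> A \<and> limitin X s x sequentially}" for A
  have seqcl_sup: "A \<subseteq> seqcl A" if "A \<subseteq> topspace X" for A
  proof
    fix x assume "x \<in> A"
    with that have "range (\<lambda>n::nat. x) \<subseteq> A" "limitin X (\<lambda>n::nat. x) x sequentially" by auto
    then show "x \<in> seqcl A"
      unfolding seqcl_def by (intro CollectI exI[of _ "\<lambda>n. x"] conjI)
  qed
  have closed: "closedin X (seqcl A)" if A: "A \<subseteq> topspace X" for A
  proof (rule closedin_sequential_space[OF sequential])
    show "seqcl A \<subseteq> topspace X"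
      unfolding seqcl_def by (auto dest: limitin_topspace)
    fix y y0 assume y: "range y \<subseteq> seqcl A" "limitin X y y0 sequentially"
    then have "\<forall>i. \<exists>s::nat \<Rightarrow> 'a. range s \<subseteq> A \<and> limitin X s (y i) sequentially"
      unfolding seqcl_def by blast
    from choice[OF this] obtain x :: "nat \<Rightarrow> nat \<Rightarrow> 'a" where
      x: "\<And>i. range (x i) \<subseteq> A" "\<And>i. limitin X (x i) (y i) sequentially" by blast
    have y_in: "y i \<in> topspace X" and x_in: "x i k \<in> topspace X" for i k
      using limitin_topspace[OF x(2)] x(1) A by blast+
    \<comment> \<open>With \<open>k\<close> depending on \<open>i\<close>, these quotients enter
      every \<open>T j\<close> and so tend to \<open>e\<close>; multiplying \<open>y i\<close> by
      them recovers a diagonal sequence in \<open>A\<close> with limit \<open>y0\<close>.\<close>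
    have "\<exists>k. \<forall>j\<le>i. dl (y i) (x i k) \<in> T j" for i
    proof -
      have "limitin X (\<lambda>k. dl (y i) (x i k)) (dl (y i) (y i)) sequentially"
        by (intro limitin_dl x(2)) (simp add: y_in)
      then have "limitin X (\<lambda>k. dl (y i) (x i k)) e sequentially"
        by (simp add: dl_self y_in)
      moreover have "range (\<lambda>k. dl (y i) (x i k)) \<subseteq> topspace X"
        using dl_in[OF y_in x_in] by auto
      ultimately have "\<forall>\<^sub>F k in sequentially. \<forall>j\<in>{..i}. dl (y i) (x i k) \<in> T j"
        using barrier_eventually[OF T_bar] by (intro eventually_ball_finite) auto
      from eventually_happens[OF this] show ?thesis
        by auto
    qed
    then have "\<forall>i. \<exists>k. \<forall>j\<le>i. dl (y i) (x i k) \<in> T j" by blast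
    from choice[OF this] obtain k where k: "\<And>i j. j \<le> i \<Longrightarrow> dl (y i) (x i (k i)) \<in> T j" by blast
    have "limitin X (\<lambda>i. dl (y i) (x i (k i))) e sequentially"
      unfolding limitin_sequentially
    proof (intro conjI allI impI e_in)
      fix U assume "openin X U \<and> e \<in> U"
      then obtain n where "T n \<subseteq> U"
        using T_base' by blast
      then show "\<exists>n. \<forall>i\<ge>n. dl (y i) (x i (k i)) \<in> U"
        using k by blast
    qed
    from limitin_mu[OF y(2) this]
    have "limitin X (\<lambda>i. mu (y i) (dl (y i) (x i (k i)))) (mu y0 e) sequentially" .
    then have "limitin X (\<lambda>i. x i (k i)) y0 sequentially"
      using limitin_topspace[OF y(2)] by (simp add: mu_dl y_in x_in mu_e)
    moreover have "range (\<lambda>i. x i (k i)) \<subseteq> A"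
      using x(1) by blast
    ultimately show "y0 \<in> seqcl A"
      unfolding seqcl_def by blast
  qed
  define U where "U n = topspace X - seqcl (topspace X - T n)" for n
  show thesis
  proof (rule that)
    fix n
    show "openin X (U n)"
      unfolding U_def using closed[of "topspace X - T n"] by blast
    show "e \<in> U n"
    proof (rule ccontr)
      assume "e \<notin> U n"
      then obtain s :: "nat \<Rightarrow> 'a" where
        s: "range s \<subseteq> topspace X - T n" "limitin X s e sequentially"
        unfolding U_def seqcl_def using e_in by blast
      then have "\<exists>i. s i \<in> T n"
        using T_bar[of n] unfolding barrier_def by blast
      then show False
        using s(1) by blast
    qed
  next
    fix V assume "openin X V" "e \<in> V"
    then obtain n where "T n \<subseteq> V"
      using T_base' by blast
    moreover have "U n \<subseteq> T n"
      unfolding U_def using seqcl_sup[of "topspace X - T n"] by blast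
    ultimately show "\<exists>n. U n \<subseteq> V" by blast
  qed
qed

section \<open>Clopen sets generated by a barrier\<close>

text \<open>Sequentiality reduces both claims to sequences \<open>s\<close> with limit
  \<open>x\<close>. Since \<open>dl (s n) x\<close> and \<open>dl x (s n)\<close> tend to
  \<open>e\<close>, some of them lie in \<open>K\<close>; multiplication by them leads from
  \<open>s n\<close> to \<open>x\<close> and from \<open>x\<close> to \<open>s n\<close> within
  \<open>T\<close>.\<close>

lemma
  assumes K: "barrier K" and T: "T \<subseteq> topspace X" "\<And>x y. x \<in> T \<Longrightarrow> y \<in> K \<Longrightarrow> mu x y \<in> T"
  shows openin_mu_closed: "openin X T" and closedin_mu_closed: "closedin X T"
proof -
  show "closedin X T"
  proof (rule closedin_sequential_space[OF sequential T(1)])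
    fix s x assume s: "range s \<subseteq> T" "limitin X s x sequentially"
    have x: "x \<in> topspace X" and s_in: "s n \<in> topspace X" for n
      using limitin_topspace[OF s(2)] s(1) T(1) by blast+
    have "limitin X (\<lambda>n. dl (s n) x) (dl x x) sequentially"
      by (intro limitin_dl s(2)) (simp add: x)
    then have "limitin X (\<lambda>n. dl (s n) x) e sequentially"
      by (simp add: dl_self x)
    moreover have "range (\<lambda>n. dl (s n) x) \<subseteq> topspace X"
      using dl_in[OF s_in x] by auto
    ultimately obtain n where "dl (s n) x \<in> K"
      using K unfolding barrier_def by blast
    then have "mu (s n) (dl (s n) x) \<in> T"
      using s(1) by (intro T(2)) auto
    then show "x \<in> T"
      by (simp add: mu_dl s_in x)
  qed
  have "closedin X (topspace X - T)"
  proof (rule closedin_sequential_space[OF sequential])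
    fix s x assume s: "range s \<subseteq> topspace X - T" "limitin X s x sequentially"
    have x: "x \<in> topspace X" and s_in: "s n \<in> topspace X" for n
      using limitin_topspace[OF s(2)] s(1) by blast+
    have "x \<notin> T"
    proof
      assume "x \<in> T"
      have "limitin X (\<lambda>n. dl x (s n)) (dl x x) sequentially"
        by (intro limitin_dl s(2)) (simp add: x)
      then have "limitin X (\<lambda>n. dl x (s n)) e sequentially"
        by (simp add: dl_self x)
      moreover have "range (\<lambda>n. dl x (s n)) \<subseteq> topspace X"
        using dl_in[OF x s_in] by auto
      ultimately obtain n where "dl x (s n) \<in> K"
        using K unfolding barrier_def by blast
      then have "mu x (dl x (s n)) \<in> T"
        using \<open>x \<in> T\<close> by (intro T(2)) auto
      then show False
        using s(1) by (auto simp: mu_dl s_in x)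
    qed
    with x show "x \<in> topspace X - T" by blast
  qed auto
  then show "openin X T"
    using T(1) openin_closedin_eq by blast
qed

text \<open>The network consists of the sets of points near a centre, with finitely many centres for
  each of countably many \<open>T\<close>. Continuity of \<open>mu\<close> is applied twice, to pass
  from \<open>x\<close> to a centre and from there to the other points near it.\<close>

lemma precompact_imp_countable_network:
  assumes "precompact P" "P \<subseteq> topspace X"
  shows "has_countable_network X P"
proof -
  let ?cov = "\<lambda>T F. finite F \<and> F \<subseteq> topspace X \<and> P \<subseteq> (\<Union>f\<in>F. {y. near T f y})"
  define \<T> where "\<T> = {T \<in> finite_unions. \<exists>F. ?cov T F}"
  have "\<forall>T\<in>\<T>. \<exists>F. ?cov T F"
    unfolding \<T>_def by blast
  \<comment> \<open>The centres depend on \<open>T\<close> only, not on the \<open>V\<close> and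
    \<open>n\<close> with \<open>T = B V n\<close>; this keeps \<open>\<W>\<close>
    countable.\<close>
  from bchoice[OF this] obtain F where F: "\<forall>T\<in>\<T>. ?cov T (F T)" ..
  define \<W> where "\<W> = (\<Union>T\<in>\<T>. (\<lambda>f. {y \<in> topspace X. near T f y}) ` F T)"
  show ?thesis
    unfolding has_countable_network_def
  proof (intro exI[of _ \<W>] conjI ballI allI impI)
    have "\<T> \<subseteq> finite_unions"
      unfolding \<T>_def by blast
    then have "countable \<T>"
      using countable_finite_unions countable_subset by blast
    then show "countable \<W>"
      unfolding \<W>_def using F by (intro countable_UN) (auto intro: countable_finite)
  next
    fix x U assume "x \<in> P" and "openin X U \<and> x \<in> U"
    then have x: "x \<in> topspace X" and U: "openin X U" "mu x e \<in> U"
      using assms(2) by (auto simp: mu_e)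
    from continuous_map_pair_nhds[OF cont_mu x e_in U] obtain U1 V1 where
      1: "openin X U1" "x \<in> U1" "openin X V1" "e \<in> V1"
        "\<And>a b. a \<in> U1 \<Longrightarrow> b \<in> V1 \<Longrightarrow> mu a b \<in> U" by blast
    have "mu x e \<in> U1"
      using 1 x by (simp add: mu_e)
    from continuous_map_pair_nhds[OF cont_mu x e_in 1(1) this] obtain U2 V2 where
      2: "openin X U2" "x \<in> U2" "openin X V2" "e \<in> V2"
        "\<And>a b. a \<in> U2 \<Longrightarrow> b \<in> V2 \<Longrightarrow> mu a b \<in> U1" by blast
    have V: "openin X (V1 \<inter> V2)" "e \<in> V1 \<inter> V2"
      using 1 2 by auto
    obtain n where n: "\<exists>F. ?cov (B (V1 \<inter> V2) n) F"
      using assms(1)[unfolded precompact_def, rule_format, OF conjI[OF V]] ..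
    define T where "T = B (V1 \<inter> V2) n"
    have T: "T \<in> \<T>" "T \<subseteq> V1 \<inter> V2"
      using n B_in_finite_unions B_subset[OF V(2)] unfolding \<T>_def T_def by simp_all
    then obtain f where f: "f \<in> F T" "near T f x"
      using F \<open>x \<in> P\<close> by blast
    then have f_in: "f \<in> topspace X"
      using F T by blast
    \<comment> \<open>Both halves of \<open>near\<close> are needed: \<open>dl x f\<close> leads to
      the centre, \<open>dl f y\<close> away from it.\<close>
    have "mu x (dl x f) \<in> U1"
      using f(2) T(2) 2 unfolding near_def by blast
    then have "f \<in> U1"
      by (simp add: mu_dl x f_in)
    have "y \<in> U" if "y \<in> topspace X" "near T f y" for y
    proof -
      have "mu f (dl f y) \<in> U"
        using that(2) T(2) 1(5) \<open>f \<in> U1\<close> unfolding near_def by blast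
      then show ?thesis
        by (simp add: mu_dl that f_in)
    qed
    then show "\<exists>W\<in>\<W>. x \<in> W \<and> W \<subseteq> U"
      using f x T(1) unfolding \<W>_def
      by (intro bexI[of _ "{y \<in> topspace X. near T f y}"]) auto
  qed
qed

text \<open>\<open>H x\<close> is the smallest set that contains \<open>x\<close> and is closed
  under right multiplication by \<open>K\<close>; it arises in countably many steps, each preserving
  countable networks. Unions of such sets are again closed under this multiplication, hence
  clopen.\<close>

lemma clopen_cover_with_countable_networks:
  assumes V: "openin X V" "e \<in> V" and no: "\<And>n. \<not> barrier (B V n)"
  obtains H :: "'a \<Rightarrow> 'a set" where "\<And>x. x \<in> topspace X \<Longrightarrow> x \<in> H x"
    "\<And>x. x \<in> topspace X \<Longrightarrow> has_countable_network X (H x)"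
    "\<And>I. I \<subseteq> topspace X \<Longrightarrow> openin X (\<Union>x\<in>I. H x)"
    "\<And>I. I \<subseteq> topspace X \<Longrightarrow> closedin X (\<Union>x\<in>I. H x)"
proof (rule countable_precompact_family[OF assms])
  fix \<P> assume \<P>: "countable \<P>" "\<And>P. P \<in> \<P> \<Longrightarrow> precompact P" "barrier (\<Union>\<P>)"
    "\<Union>\<P> \<subseteq> topspace X"
  define K where "K = \<Union>\<P>"
  have K_net: "has_countable_network X K"
  proof -
    have "has_countable_network X (\<Union>P\<in>\<P>. P)"
      using \<P>(2,4) by (intro has_countable_network_UN \<P>(1) precompact_imp_countable_network) auto
    then show ?thesis
      by (simp add: K_def)
  qed
  define step where "step A = {mu a b |a b. a \<in> A \<and> b \<in> K}" for A
  define H where "H x = (\<Union>n. (step ^^ n) {x})" for x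
  have fin: "(step ^^ n) {x} \<subseteq> topspace X \<and> has_countable_network X ((step ^^ n) {x})"
    if x: "x \<in> topspace X" for x n
  proof (induction n)
    case 0
    then show ?case
      using x by (simp add: has_countable_network_singleton)
  next
    case (Suc n)
    have "step A \<subseteq> topspace X" if "A \<subseteq> topspace X" for A
      using that \<P>(4) mu_in unfolding step_def K_def by blast
    moreover have "has_countable_network X (step A)"
      if "A \<subseteq> topspace X" "has_countable_network X A" for A
      unfolding step_def
      using that \<P>(4) K_net
      by (intro has_countable_network_continuous_pair_image[OF cont_mu]) (auto simp: K_def)
    ultimately show ?case
      using Suc.IH by simp
  qed
  have H_mu: "mu a b \<in> H x" if a: "a \<in> H x" and b: "b \<in> K" for a b x
  proof -
    obtain n where "a \<in> (step ^^ n) {x}"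
      using a unfolding H_def by blast
    then have "mu a b \<in> (step ^^ Suc n) {x}"
      using b by (auto simp: step_def)
    then show ?thesis
      unfolding H_def by blast
  qed
  have H_sub: "H x \<subseteq> topspace X" if "x \<in> topspace X" for x
    unfolding H_def using fin[OF that] by blast
  have "barrier K"
    using \<P>(3) by (simp add: K_def)
  show thesis
  proof (rule that[of H])
    fix x assume x: "x \<in> topspace X"
    have "x \<in> (step ^^ 0) {x}" by simp
    then show "x \<in> H x"
      unfolding H_def by blast
    show "has_countable_network X (H x)"
      unfolding H_def using fin[OF x] by (intro has_countable_network_UN) auto
  next
    fix I assume "I \<subseteq> topspace X"
    then have "(\<Union>x\<in>I. H x) \<subseteq> topspace X"
      using H_sub by blast
    then show "openin X (\<Union>x\<in>I. H x)" "closedin X (\<Union>x\<in>I. H x)"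
      using H_mu \<open>barrier K\<close>
      by (auto intro!: openin_mu_closed[of K] closedin_mu_closed[of K])
  qed
qed

end

section \<open>Combination of the two cases\<close>

text \<open>By regularity each neighbourhood contains the closure of a smaller one, so the closures
  of the network sets inside the latter still fit, and they contain no fewer terms of a
  sequence.\<close>

lemma cs_star_network_imp_cs_rectified_space:
  assumes "rectified_space X e mu dl" "sequential_space X" "countable_cs_star_character X"
  obtains N where "cs_rectified_space X e mu dl N"
proof -
  interpret rectified_space X e mu dl by fact
  obtain \<N> where \<N>: "countable \<N>" "cs_star_network_at X e \<N>"
    using assms(3) e_in unfolding countable_cs_star_character_def by blast
  have sub: "M \<subseteq> topspace X" if "M \<in> \<N>" for M
    using \<N>(2) that unfolding cs_star_network_at_def by blast
  have net: "\<exists>M\<in>\<N>. M \<subseteq> U \<and> infinite {n. s n \<in> M}"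
    if "openin X U" "e \<in> U" "range s \<subseteq> topspace X" "limitin X s e sequentially" for U s
    using \<N>(2) that unfolding cs_star_network_at_def by meson
  \<comment> \<open>The constant sequence \<open>e\<close> must be met, so there is a member and
    \<open>from_nat_into\<close> enumerates \<open>\<N>\<close>.\<close>
  have ne: "\<N> \<noteq> {}"
    using net[OF openin_topspace e_in, of "\<lambda>n. e"] e_in by auto
  define N where "N i = X closure_of (from_nat_into \<N> i)" for i
  have "cs_rectified_space X e mu dl N"
  proof
    show "closedin X (N i)" for i
      unfolding N_def by simp
    fix U s assume U: "openin X U" "e \<in> U"
      and s: "range s \<subseteq> topspace X" "limitin X s e sequentially"
    obtain V where V: "openin X V" "e \<in> V" "X closure_of V \<subseteq> U"
      using regular_space_shrink[OF reg U] by blast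
    obtain M where M: "M \<in> \<N>" "M \<subseteq> V" "infinite {n. s n \<in> M}"
      using net[OF V(1,2) s] by blast
    obtain i where i: "from_nat_into \<N> i = M"
      using from_nat_into_surj[OF \<N>(1) M(1)] by blast
    have "M \<subseteq> N i"
      unfolding N_def i using sub[OF M(1)] by (rule closure_of_subset)
    then have "{n. s n \<in> M} \<subseteq> {n. s n \<in> N i}"
      by blast
    then have "infinite {n. s n \<in> N i}"
      using M(3) by (rule infinite_super)
    moreover have "N i \<subseteq> U"
      unfolding N_def i using closure_of_mono[OF M(2)] V(3) by blast
    ultimately show "\<exists>i. N i \<subseteq> U \<and> infinite {n. s n \<in> N i}"
      by blast
  qed (rule assms(2))
  then show thesis ..
qed

theorem corollary1p2:
  fixes X :: "'a topology"
  assumes "regular_space X" and "t1_space X"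
    and "sequential_space X"
    and "rectifiable_space X"
    and "countable_cs_star_character X"
  shows "paracompact_space X \<and> submetrizable_space X"
proof -
  obtain e mu dl where r: "rectified_space X e mu dl"
    using rectifiable_space_imp_rectified_space[OF assms(1,2,4)] by blast
  obtain N where "cs_rectified_space X e mu dl N"
    using cs_star_network_imp_cs_rectified_space[OF r assms(3,5)] by blast
  then interpret cs_rectified_space X e mu dl N .
  \<comment> \<open>Besides paracompactness, each case supplies open sets with intersection
    \<open>{e}\<close>, from which the continuous metric is obtained.\<close>
  have "paracompact_space X \<and> (\<exists>G::nat \<Rightarrow> 'a set.
      (\<forall>n. openin X (G n) \<and> e \<in> G n) \<and> (\<Inter>n. G n) \<subseteq> {e})"
  proof (cases "\<forall>V. openin X V \<and> e \<in> V \<longrightarrow> (\<exists>n. barrier (B V n))")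
    case True
    then obtain U :: "nat \<Rightarrow> 'a set" where U: "\<And>n. openin X (U n)" "\<And>n. e \<in> U n"
      "\<And>V. openin X V \<Longrightarrow> e \<in> V \<Longrightarrow> \<exists>n. U n \<subseteq> V"
      using barriers_imp_first_countable by metis
    have "(\<Inter>n. U n) \<subseteq> {e}"
    proof
      fix y assume y: "y \<in> (\<Inter>n. U n)"
      then have y_in: "y \<in> topspace X"
        using openin_subset[OF U(1)[of 0]] by blast
      show "y \<in> {e}"
      proof (rule ccontr)
        assume "y \<notin> {e}"
        moreover have "closedin X {y}"
          using t1 y_in by (simp add: t1_space_closedin_singleton)
        ultimately have "openin X (topspace X - {y})" "e \<in> topspace X - {y}"
          using e_in by auto
        then show False
          using U(3) y by blast
      qed
    qed
    then show ?thesis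
      using first_countable_imp_paracompact[OF U] U(1,2) by blast
  next
    case False
    then obtain V where V: "openin X V" "e \<in> V" "\<And>n. \<not> barrier (B V n)"
      by blast
    show ?thesis
    proof (rule clopen_cover_with_countable_networks[OF V])
      fix H :: "'a \<Rightarrow> 'a set"
      assume H: "\<And>x. x \<in> topspace X \<Longrightarrow> x \<in> H x"
        "\<And>x. x \<in> topspace X \<Longrightarrow> has_countable_network X (H x)"
        "\<And>I. I \<subseteq> topspace X \<Longrightarrow> openin X (\<Union>x\<in>I. H x)"
        "\<And>I. I \<subseteq> topspace X \<Longrightarrow> closedin X (\<Union>x\<in>I. H x)"
      have "openin X (H e)"
        using H(3)[of "{e}"] e_in by simp
      from countable_network_imp_G_delta[OF this H(1)[OF e_in] H(2)[OF e_in]]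
      obtain G :: "nat \<Rightarrow> 'a set"
        where "\<And>n. openin X (G n)" "\<And>n. e \<in> G n" "(\<Inter>n. G n) \<subseteq> {e}" by blast
      then show ?thesis
        by (intro conjI clopen_cover_imp_paracompact[OF reg Hausdorff H] exI[of _ G]) auto
    qed
  qed
  then show ?thesis
    using paracompact_imp_submetrizable by blast
qed

end
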